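(* Let $\mathbb{F}$ be a field of characteristic $2$ with $|\mathbb{F}|>2$. Let $\Gamma$ be the reduct of the lift of $\widetilde H_3(\mathbb{F})$ with respect to $\ell^U$, let $N=S_2(W)/\langle U\rangle_{\mathbb{F}_2}$, and let $\mathrm{SL}_4(\mathbb{F})\ltimes N$ act on $\Gamma$ by $([v\otimes f],n)^{(g,k)}=([v^g\otimes f^g],n^g+k)$. Then the stabilizer $H$ in $\mathrm{SL}_4(\mathbb{F})\ltimes N$ of a connected component of $\Gamma$ is a non-split extension of $\mathrm{SL}_4(\mathbb{F})$ by (a normal subgroup isomorphic to) $\mathbb{F}^6$.
   Context: Groups act on the right. All graphs are simple and undirected; a dart is an ordered pair $(u,v)$ of adjacent vertices. For a voltage assignment $\ell:D(\Delta)\to N$ into an abelian group $N$ (written additively, with $\ell(v,u)=-\ell(u,v)$), the lift of $\Delta$ is the graph on $V(\Delta)\times N$ with $(u,m)\perp(v,n)$ iff $u\perp v$ and $\ell(u,v)=m-n$. The reduct $\Gamma'/\sim$ of a graph $\Gamma'$ identifies vertices with equal neighbourhoods; in the lift considered here, the class of $(v\otimes f,n)$ is written $([v\otimes f],n)$, where $[v\otimes f]$ is the class of $v\otimes f$ in $\widetilde H_3(\mathbb{F})$. Let $V=\mathbb{F}^4$, $V^*$ its dual, with $\mathrm{SL}_4(\mathbb{F})=\mathrm{SL}(V)$ acting naturally on $V$, $V^*$ and all tensor constructions. $\widetilde H_3(\mathbb{F})$ is the graph whose vertices are the tensors $v\otimes f\in V\otimes V^*$ with $f(v)\neq0$, with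 $v\otimes f\perp w\otimes g$ iff $f(w)=g(v)=0$. Let $W=\bigwedge^2V$. Fix an isomorphism $\chi:\bigwedge^4V\to\mathbb{F}$. Identify $\bigwedge^2V^*$ with $(\bigwedge^2V)^*$ via $(f_1\wedge f_2)(v_1\wedge v_2)=f_1(v_1)f_2(v_2)-f_1(v_2)f_2(v_1)$; let $\psi:\bigwedge^2V\to\bigwedge^2V^*$ be $\psi(\hat w)(\hat v)=\chi(\hat v\wedge\hat w)$ and $\phi=\psi^{-1}$. $S_2(W)$ is the symmetric square of $W$, with product written $ab$. $U=(w\wedge x)(y\wedge z)+(w\wedge y)(z\wedge x)+(w\wedge z)(x\wedge y)$ for any $w,x,y,z\in V$ with $\chi(w\wedge x\wedge y\wedge z)=1$ (independent of the choice and $\mathrm{SL}(V)$-invariant). $\ell$ assigns to the dart from $v_1\otimes h_1$ to $v_2\otimes h_2$ the element $h_1(v_1)^{-1}h_2(v_2)^{-1}(v_1\wedge v_2)\,\phi(h_1\wedge h_2)\in S_2(W)$, and $\ell^U$ is its composition with $S_2(W)\to S_2(W)/\langle U\rangle_{\mathbb{F}_2}$. *)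

theory Defs
  imports "HOL-Analysis.Determinants" "HOL-Algebra.Coset"
begin

section \<open>Linear algebra over a field F, with V = F^4 (row vectors, right action)\<close>

type_synonym 'a V = "'a ^ 4"
type_synonym 'a Vd = "'a ^ 4"      (* dual vectors: f(v) = sum_i v_i f_i *)
type_synonym 'a mat4 = "'a ^ 4 ^ 4"

definition pair :: "'a::field Vd \<Rightarrow> 'a V \<Rightarrow> 'a" where
  "pair f v = (\<Sum>i\<in>UNIV. f $ i * v $ i)"

definition SL4 :: "'a::field mat4 set" where
  "SL4 = {g. det g = 1}"

text \<open>v^g = v g (row vector times matrix); f^g is defined by f^g(v^g) = f(v).\<close>
definition vact :: "'a::field mat4 \<Rightarrow> 'a V \<Rightarrow> 'a V" where
  "vact g v = v v* g"
definition dact :: "'a::field mat4 \<Rightarrow> 'a Vd \<Rightarrow> 'a Vd" where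
  "dact g f = matrix_inv g *v f"

text \<open>The fixed isomorphism chi : wedge^4 V -> F is c times the determinant
  (every such isomorphism has this form for some nonzero c).\<close>
definition chi4 :: "'a::field \<Rightarrow> 'a V \<Rightarrow> 'a V \<Rightarrow> 'a V \<Rightarrow> 'a V \<Rightarrow> 'a" where
  "chi4 c x1 x2 x3 x4 = c * det (vector [x1, x2, x3, x4] :: 'a mat4)"

section \<open>W = wedge^2 V, as alternating 4x4 matrices (Pluecker coordinates A$i$j, i<j)\<close>

definition Pidx :: "(4 \<times> 4) set" where
  "Pidx = {(i, j). i < j}"

definition Wset :: "'a::field mat4 set" where
  "Wset = {A. (\<forall>i. A $ i $ i = 0) \<and> (\<forall>i j. A $ i $ j = - A $ j $ i)}"

definition wedge :: "'a::field V \<Rightarrow> 'a V \<Rightarrow> 'a mat4" where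
  "wedge v w = (\<chi> i j. v $ i * w $ j - v $ j * w $ i)"

definition Wbas :: "4 \<times> 4 \<Rightarrow> 'a::field mat4" where
  "Wbas I = wedge (axis (fst I) 1) (axis (snd I) 1)"

definition wco :: "'a::field mat4 \<Rightarrow> 4 \<times> 4 \<Rightarrow> 'a" where
  "wco A I = A $ fst I $ snd I"

text \<open>(v \<and> w)^g = v^g \<and> w^g, i.e. A \<mapsto> g^T A g.\<close>
definition wact :: "'a::field mat4 \<Rightarrow> 'a mat4 \<Rightarrow> 'a mat4" where
  "wact g A = transpose g ** A ** g"

text \<open>chi(A \<and> B) for A, B in wedge^2 V.\<close>
definition chiW :: "'a::field \<Rightarrow> 'a mat4 \<Rightarrow> 'a mat4 \<Rightarrow> 'a" where
  "chiW c A B = (\<Sum>I\<in>Pidx. \<Sum>J\<in>Pidx. wco A I * wco B J *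
      chi4 c (axis (fst I) 1) (axis (snd I) 1) (axis (fst J) 1) (axis (snd J) 1))"

text \<open>h1 \<and> h2 in wedge^2 V^*, viewed as a functional on wedge^2 V via
  (f1 \<and> f2)(v1 \<and> v2) = f1(v1) f2(v2) - f1(v2) f2(v1), extended linearly.\<close>
definition dwedge :: "'a::field Vd \<Rightarrow> 'a Vd \<Rightarrow> 'a mat4 \<Rightarrow> 'a" where
  "dwedge h1 h2 A = (\<Sum>I\<in>Pidx. wco A I * (h1 $ fst I * h2 $ snd I - h1 $ snd I * h2 $ fst I))"

definition psi :: "'a::field \<Rightarrow> 'a mat4 \<Rightarrow> ('a mat4 \<Rightarrow> 'a)" where
  "psi c B = (\<lambda>A. chiW c A B)"

definition phi :: "'a::field \<Rightarrow> ('a mat4 \<Rightarrow> 'a) \<Rightarrow> 'a mat4" where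
  "phi c X = (THE B. B \<in> Wset \<and> psi c B = X)"

section \<open>S_2(W), the symmetric square: an element is given by its coefficients on the
  monomial basis E_I E_J (I, J in Pidx), stored symmetrically: s(I,I) is the coefficient
  of E_I^2 and s(I,J) = s(J,I) (I \<noteq> J) is the coefficient of E_I E_J.\<close>

type_synonym 'a S2 = "(4 \<times> 4) \<times> (4 \<times> 4) \<Rightarrow> 'a"

definition S2set :: "'a::field S2 set" where
  "S2set = {s. (\<forall>I J. s (I, J) = s (J, I)) \<and> (\<forall>I J. (I \<notin> Pidx \<or> J \<notin> Pidx) \<longrightarrow> s (I, J) = 0)}"

definition splus :: "'a::field S2 \<Rightarrow> 'a S2 \<Rightarrow> 'a S2" where
  "splus s t = (\<lambda>x. s x + t x)"
definition sminus :: "'a::field S2 \<Rightarrow> 'a S2 \<Rightarrow> 'a S2" where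
  "sminus s t = (\<lambda>x. s x - t x)"
definition sscale :: "'a::field \<Rightarrow> 'a S2 \<Rightarrow> 'a S2" where
  "sscale a s = (\<lambda>x. a * s x)"
definition szero :: "'a::field S2" where
  "szero = (\<lambda>x. 0)"

text \<open>The product ab of a, b in W.\<close>
definition smul :: "'a::field mat4 \<Rightarrow> 'a mat4 \<Rightarrow> 'a S2" where
  "smul a b = (\<lambda>(I, J). if I \<in> Pidx \<and> J \<in> Pidx then
       (if I = J then wco a I * wco b I else wco a I * wco b J + wco a J * wco b I) else 0)"

definition plex :: "4 \<times> 4 \<Rightarrow> 4 \<times> 4 \<Rightarrow> bool" where
  "plex I J = (fst I < fst J \<or> (fst I = fst J \<and> snd I < snd J))"

text \<open>Induced action on S_2(W): the linear map with (ab)^g = a^g b^g.\<close>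
definition sact :: "'a::field mat4 \<Rightarrow> 'a S2 \<Rightarrow> 'a S2" where
  "sact g s = (\<lambda>x. (\<Sum>(I, J)\<in>{(I, J). I \<in> Pidx \<and> J \<in> Pidx \<and> (I = J \<or> plex I J)}.
       s (I, J) * smul (wact g (Wbas I)) (wact g (Wbas J)) x))"

text \<open>U, computed with w = c^{-1} e_1, x = e_2, y = e_3, z = e_4, so chi(w \<and> x \<and> y \<and> z) = 1.\<close>
definition Uel :: "'a::field \<Rightarrow> 'a S2" where
  "Uel c = (let w = inverse c *s axis 1 1; x = axis 2 1; y = axis 3 1; z = axis 4 1 in
     splus (splus (smul (wedge w x) (wedge y z)) (smul (wedge w y) (wedge z x)))
           (smul (wedge w z) (wedge x y)))"

section \<open>N = S_2(W) / <U>_{F_2}; since char F = 2, <U>_{F_2} = {0, U}\<close>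

definition Ncl :: "'a::field \<Rightarrow> 'a S2 \<Rightarrow> 'a S2 set" where
  "Ncl c s = {splus s t | t. t \<in> {szero, Uel c}}"

definition Ncarrier :: "'a::field \<Rightarrow> 'a S2 set set" where
  "Ncarrier c = Ncl c ` S2set"

definition nadd :: "'a::field S2 set \<Rightarrow> 'a S2 set \<Rightarrow> 'a S2 set" where
  "nadd X Y = {splus x y | x y. x \<in> X \<and> y \<in> Y}"
definition nsub :: "'a::field S2 set \<Rightarrow> 'a S2 set \<Rightarrow> 'a S2 set" where
  "nsub X Y = {sminus x y | x y. x \<in> X \<and> y \<in> Y}"
definition nact :: "'a::field mat4 \<Rightarrow> 'a S2 set \<Rightarrow> 'a S2 set" where
  "nact g X = sact g ` X"

section \<open>The voltage assignment\<close>

definition ell :: "'a::field \<Rightarrow> 'a V \<Rightarrow> 'a Vd \<Rightarrow> 'a V \<Rightarrow> 'a Vd \<Rightarrow> 'a S2" where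
  "ell c v1 h1 v2 h2 = sscale (inverse (pair h1 v1) * inverse (pair h2 v2))
      (smul (wedge v1 v2) (phi c (dwedge h1 h2)))"

definition ellU :: "'a::field \<Rightarrow> 'a V \<Rightarrow> 'a Vd \<Rightarrow> 'a V \<Rightarrow> 'a Vd \<Rightarrow> 'a S2 set" where
  "ellU c v1 h1 v2 h2 = Ncl c (ell c v1 h1 v2 h2)"

section \<open>The graph \<tilde>H_3(F): vertices are tensors v \<otimes> f (as matrices (v_i f_j)) with f(v) \<noteq> 0\<close>

definition tens :: "'a::field V \<Rightarrow> 'a Vd \<Rightarrow> 'a mat4" where
  "tens v f = (\<chi> i j. v $ i * f $ j)"

definition HV :: "'a::field mat4 set" where
  "HV = {tens v f | v f. pair f v \<noteq> 0}"

definition Hadj :: "'a::field mat4 \<Rightarrow> 'a mat4 \<Rightarrow> bool" where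
  "Hadj T T' = (T \<in> HV \<and> T' \<in> HV \<and>
     (\<exists>v f w g. T = tens v f \<and> T' = tens w g \<and> pair f w = 0 \<and> pair g v = 0))"

section \<open>The lift with respect to ell^U, and its reduct\<close>

definition LV :: "'a::field \<Rightarrow> ('a mat4 \<times> 'a S2 set) set" where
  "LV c = HV \<times> Ncarrier c"

definition Ladj :: "'a::field \<Rightarrow> 'a mat4 \<times> 'a S2 set \<Rightarrow> 'a mat4 \<times> 'a S2 set \<Rightarrow> bool" where
  "Ladj c x y = (x \<in> LV c \<and> y \<in> LV c \<and> Hadj (fst x) (fst y) \<and>
     (\<exists>v f w g. fst x = tens v f \<and> fst y = tens w g \<and>
        ellU c v f w g = nsub (snd x) (snd y)))"

definition Lnbhd :: "'a::field \<Rightarrow> 'a mat4 \<times> 'a S2 set \<Rightarrow> ('a mat4 \<times> 'a S2 set) set" where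
  "Lnbhd c x = {y \<in> LV c. Ladj c x y}"

definition rclass :: "'a::field \<Rightarrow> 'a mat4 \<times> 'a S2 set \<Rightarrow> ('a mat4 \<times> 'a S2 set) set" where
  "rclass c x = {y \<in> LV c. Lnbhd c y = Lnbhd c x}"

definition RV :: "'a::field \<Rightarrow> ('a mat4 \<times> 'a S2 set) set set" where
  "RV c = rclass c ` LV c"

definition Radj :: "'a::field \<Rightarrow> ('a mat4 \<times> 'a S2 set) set rel" where
  "Radj c = {(X, Y). X \<in> RV c \<and> Y \<in> RV c \<and> (\<exists>x\<in>X. \<exists>y\<in>Y. Ladj c x y)}"

definition Rcomponents :: "'a::field \<Rightarrow> ('a mat4 \<times> 'a S2 set) set set set" where
  "Rcomponents c = {(Radj c)\<^sup>* `` {X} | X. X \<in> RV c}"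

section \<open>The group SL_4(F) \<ltimes> N and its action on the reduct\<close>

definition SDP :: "'a::field \<Rightarrow> ('a mat4 \<times> 'a S2 set) monoid" where
  "SDP c = \<lparr>carrier = SL4 \<times> Ncarrier c,
            mult = (\<lambda>(g, k) (g', k'). (g ** g', nadd (nact g' k) k')),
            one = (mat 1, Ncl c szero)\<rparr>"

definition tact :: "'a::field mat4 \<Rightarrow> 'a mat4 \<Rightarrow> 'a mat4" where
  "tact g T = (SOME T'. \<exists>v f. T = tens v f \<and> T' = tens (vact g v) (dact g f))"

text \<open>([v \<otimes> f], n)^(g,k) = ([v^g \<otimes> f^g], n^g + k).\<close>
definition ract :: "'a::field \<Rightarrow> 'a mat4 \<times> 'a S2 set \<Rightarrow> ('a mat4 \<times> 'a S2 set) set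
                      \<Rightarrow> ('a mat4 \<times> 'a S2 set) set" where
  "ract c h X = (let x = (SOME x. x \<in> X) in
     rclass c (tact (fst h) (fst x), nadd (nact (fst h) (snd x)) (snd h)))"

definition stabC :: "'a::field \<Rightarrow> ('a mat4 \<times> 'a S2 set) set set \<Rightarrow> ('a mat4 \<times> 'a S2 set) set" where
  "stabC c C = {h \<in> carrier (SDP c). ract c h ` C = C}"

section \<open>Target groups\<close>

definition SLgrp :: "'a::field mat4 monoid" where
  "SLgrp = \<lparr>carrier = SL4, mult = (**), one = mat 1\<rparr>"

definition F6grp :: "('a::field ^ 6) monoid" where
  "F6grp = \<lparr>carrier = UNIV, mult = (+), one = 0\<rparr>"

definition nonsplit_ext :: "('g, 'm) monoid_scheme \<Rightarrow> 'g set \<Rightarrow> bool" where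
  "nonsplit_ext H K = (\<not> (\<exists>C. subgroup C H \<and> C \<inter> K = {\<one>\<^bsub>H\<^esub>} \<and> K <#>\<^bsub>H\<^esub> C = carrier H))"

end

theory Submission
  imports Defs
begin

text \<open>
  Every edge voltage is the value at its two ends of a potential, up to \<open>U\<close> and up to the
  \<open>F\<close>-span \<open>SQ\<close> of the squares in \<open>S\<^sub>2(W)\<close>; the potential is linear in the normalised tensor
  \<open>v \<otimes> f / f(v)\<close>. Hence all closed walks have voltage in \<open>SQ\<close> modulo \<open>U\<close>. Conversely, quadrangles
  on \<open>e\<^sub>i \<otimes> e\<^sub>i*, e\<^sub>k \<otimes> e\<^sub>k*, e\<^sub>i \<otimes> (e\<^sub>i* + a e\<^sub>j*), e\<^sub>k \<otimes> (e\<^sub>k* + b e\<^sub>l*)\<close> have voltage a multiple of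
  \<open>(e\<^sub>i \<and> e\<^sub>k)\<^sup>2\<close>, so closed walks realise all of \<open>SQ\<close>, a copy of \<open>F\<^sup>6\<close>. As the antiflag graph is
  connected, the stabilizer of a component projects onto \<open>SL\<^sub>4\<close> with kernel \<open>SQ\<close>.

  The extension is non-split because the commuting transvections \<open>r(a): e\<^sub>3 \<mapsto> e\<^sub>3 + a e\<^sub>1\<close> and
  \<open>t(b): e\<^sub>4 \<mapsto> e\<^sub>4 + b e\<^sub>2\<close> cannot be lifted to commuting elements for all \<open>a\<close> and \<open>b\<close>: the coefficient
  of \<open>(e\<^sub>1 \<and> e\<^sub>2)\<^sup>2\<close> in the commutator would force \<open>1/(ab)\<close> to be a function of \<open>a\<close> plus a
  function of \<open>b\<close>, which is impossible as soon as \<open>F\<close> has an element besides 0 and 1.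
\<close>

section \<open>Coordinates on the exterior and symmetric squares\<close>

text \<open>The numeral 4 of type \<^typ>\<open>4\<close> is 0, hence the least element; this fixes which of the two
  orderings of an index pair lies in \<^const>\<open>Pidx\<close>.\<close>

lemma less_4:
  "(4::4) < 1" "(4::4) < 2" "(4::4) < 3" "(1::4) < 2" "(1::4) < 3" "(2::4) < 3"
  by (simp_all add: less_bit0_def bit0.Rep_1 bit0.Rep_numeral)

lemma Pidx_eq: "Pidx = {(1,2), (1,3), (2,3), (4,1), (4,2), (4,3)}"
proof -
  have "\<forall>i j::4. (i < j) = ((i,j) \<in> {(1,2), (1,3), (2,3), (4,1), (4,2), (4,3)})"
    unfolding forall_4 using less_4 by auto
  then show ?thesis unfolding Pidx_def by auto
qed

lemma sum_Pidx: "sum f Pidx = f (1,2) + f (1,3) + f (2,3) + f (4,1) + f (4,2) + f (4,3)"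
  by (simp add: Pidx_eq add.assoc)

lemma finite_Pidx [simp]: "finite Pidx"
  by (simp add: Pidx_eq)

lemma ball_Pidx: "(\<forall>I\<in>Pidx. P I) \<longleftrightarrow> P (1,2) \<and> P (1,3) \<and> P (2,3) \<and> P (4,1) \<and> P (4,2) \<and> P (4,3)"
  by (simp add: Pidx_eq)

text \<open>Laplace expansion along the first two rows. Complementary minors are coordinates of
  wedges of rows, so this form recognises coefficient identities over \<open>W\<close> as
  determinants.\<close>

lemma det_4:
  fixes A :: "'a::comm_ring_1^4^4"
  shows "det A =
    (A$1$1 * A$2$2 - A$1$2 * A$2$1) * (A$3$3 * A$4$4 - A$3$4 * A$4$3)
  - (A$1$1 * A$2$3 - A$1$3 * A$2$1) * (A$3$2 * A$4$4 - A$3$4 * A$4$2)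
  + (A$1$1 * A$2$4 - A$1$4 * A$2$1) * (A$3$2 * A$4$3 - A$3$3 * A$4$2)
  + (A$1$2 * A$2$3 - A$1$3 * A$2$2) * (A$3$1 * A$4$4 - A$3$4 * A$4$1)
  - (A$1$2 * A$2$4 - A$1$4 * A$2$2) * (A$3$1 * A$4$3 - A$3$3 * A$4$1)
  + (A$1$3 * A$2$4 - A$1$4 * A$2$3) * (A$3$1 * A$4$2 - A$3$2 * A$4$1)"
proof -
  have f1234: "finite {2::4, 3, 4}" "1 \<notin> {2::4, 3, 4}" by auto
  have f234: "finite {3::4, 4}" "2 \<notin> {3::4, 4}" by auto
  have f34: "finite {4::4}" "3 \<notin> {4::4}" by auto
  show ?thesis
    unfolding det_def UNIV_4
    unfolding sum_over_permutations_insert[OF f1234]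
    unfolding sum_over_permutations_insert[OF f234]
    unfolding sum_over_permutations_insert[OF f34]
    unfolding permutes_sing
    by (simp add: sign_swap_id sign_compose permutation_compose permutation_swap_id
        permutation_id swap_id_eq Transposition.transpose_def)
       (simp add: algebra_simps)
qed

lemma not_less_4:
  "\<not> (1::4) < 4" "\<not> (2::4) < 4" "\<not> (3::4) < 4" "\<not> (2::4) < 1" "\<not> (3::4) < 1" "\<not> (3::4) < 2"
  using less_4 by (auto dest: less_asym)

section \<open>The exterior square and its \<open>SL_4\<close>-action\<close>

lemma wedge_nth [simp]: "wedge v w $ i $ j = v $ i * w $ j - v $ j * w $ i"
  by (simp add: wedge_def)

lemma wco_pair [simp]: "wco A (i, j) = A $ i $ j"
  by (simp add: wco_def)

lemma wedge_in_Wset [simp]: "wedge v w \<in> Wset"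
  by (simp add: Wset_def)

lemma Wbas_in_Wset [simp]: "Wbas I \<in> Wset"
  by (simp add: Wbas_def)

lemma wact_wedge: "wact g (wedge v w) = wedge (v v* g) (w v* g)"
  by (simp add: vec_eq_iff wact_def matrix_matrix_mult_def vector_matrix_mult_def transpose_def sum_4 algebra_simps)

lemma axis_vmult: "axis i (1::'a::field) v* (g::'a^4^4) = g $ i"
  by (simp add: vec_eq_iff vector_matrix_mult_def axis_def if_distrib[of "\<lambda>x. x * _"] cong: if_cong)

lemma wact_Wbas: "wact g (Wbas (i, j)) = wedge (g $ i) (g $ j)"
  by (simp add: Wbas_def wact_wedge axis_vmult)

lemma wact_mult: "wact (g ** h) A = wact h (wact g A)"
  by (simp add: wact_def matrix_transpose_mul matrix_mul_assoc)

lemma wact_one [simp]: "wact (mat 1) A = A"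
  by (simp add: wact_def transpose_mat)

lemma wco_Wbas: "I \<in> Pidx \<Longrightarrow> J \<in> Pidx \<Longrightarrow> wco (Wbas I :: 'a::field mat4) J = (if I = J then 1 else 0)"
proof -
  have "\<forall>I\<in>Pidx. \<forall>J\<in>Pidx. wco (Wbas I :: 'a mat4) J = (if I = J then 1 else 0)"
    unfolding ball_Pidx by (simp add: Wbas_def axis_def)
  then show "I \<in> Pidx \<Longrightarrow> J \<in> Pidx \<Longrightarrow> ?thesis" by blast
qed

lemma Wset_coords:
  assumes "A \<in> Wset"
  shows "A $ i $ i = 0" "A $ 2 $ 1 = - A $ 1 $ 2" "A $ 3 $ 1 = - A $ 1 $ 3" "A $ 3 $ 2 = - A $ 2 $ 3"
    "A $ 1 $ 4 = - A $ 4 $ 1" "A $ 2 $ 4 = - A $ 4 $ 2" "A $ 3 $ 4 = - A $ 4 $ 3"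
  using assms unfolding Wset_def by blast+

lemma Wset_expand:
  assumes "A \<in> Wset"
  shows "A $ i $ j = (\<Sum>I\<in>Pidx. wco A I * (Wbas I :: 'a::field mat4) $ i $ j)"
proof -
  have "\<forall>i j. A $ i $ j = (\<Sum>I\<in>Pidx. wco A I * (Wbas I :: 'a::field mat4) $ i $ j)"
    unfolding forall_4 sum_Pidx
    by (simp add: Wbas_def axis_def Wset_coords[OF assms])
  then show ?thesis by blast
qed

lemma Wset_eqI:
  assumes "A \<in> Wset" "B \<in> Wset" "\<And>I. I \<in> Pidx \<Longrightarrow> wco A I = wco B I"
  shows "A = B"
  by (simp add: vec_eq_iff Wset_expand[OF assms(1)] Wset_expand[OF assms(2)] assms(3))

text \<open>The action is linear, and the six coordinates in \<open>Pidx\<close> determine a matrix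
  only when it is alternating.\<close>

lemma wact_expand:
  assumes "A \<in> Wset"
  shows "wact g A $ i $ j = (\<Sum>I\<in>Pidx. wco A I * wact g (Wbas I) $ i $ j)"
proof -
  have "wact g A $ i $ j = (\<Sum>k\<in>UNIV. \<Sum>l\<in>UNIV. g $ l $ i * A $ l $ k * g $ k $ j)"
    by (simp add: wact_def matrix_matrix_mult_def transpose_def sum_distrib_right)
  also have "\<dots> = (\<Sum>k\<in>UNIV. \<Sum>l\<in>UNIV. \<Sum>I\<in>Pidx. wco A I * (g $ l $ i * Wbas I $ l $ k * g $ k $ j))"
    by (subst Wset_expand[OF assms]) (simp add: sum_distrib_left sum_distrib_right mult_ac)
  also have "\<dots> = (\<Sum>I\<in>Pidx. \<Sum>k\<in>UNIV. \<Sum>l\<in>UNIV. wco A I * (g $ l $ i * Wbas I $ l $ k * g $ k $ j))"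
    by (simp only: sum.swap[where A = UNIV and B = Pidx])
  also have "\<dots> = (\<Sum>I\<in>Pidx. wco A I * wact g (Wbas I) $ i $ j)"
    by (simp add: wact_def matrix_matrix_mult_def transpose_def sum_distrib_left sum_distrib_right)
  finally show ?thesis .
qed

lemma wact_in_Wset [simp]:
  assumes "A \<in> Wset"
  shows "wact g A \<in> Wset"
proof -
  have E: "wact g (Wbas I) \<in> Wset" for I
    by (simp add: Wbas_def wact_wedge)
  then have "wact g (Wbas I) $ i $ i = 0" "wact g (Wbas I) $ i $ j = - wact g (Wbas I) $ j $ i" for I i j
    unfolding Wset_def by blast+
  then show ?thesis
    unfolding Wset_def mem_Collect_eq wact_expand[OF assms]
    by (metis (no_types, lifting) mult_minus_right mult_zero_right sum.cong sum.neutral_const sum_negf)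
qed

lemma wco_wact_expand:
  "A \<in> Wset \<Longrightarrow> wco (wact g A) J = (\<Sum>I\<in>Pidx. wco A I * wco (wact g (Wbas I)) J)"
  unfolding wco_def[of _ J] by (rule wact_expand)

section \<open>The symmetric square and its induced action\<close>

lemma smul_commute: "smul a b = smul b a"
  by (auto simp: smul_def fun_eq_iff mult.commute add.commute)

lemma smul_in_S2set [simp]: "smul a b \<in> S2set"
  by (auto simp: smul_def S2set_def add.commute)

lemma splus_in_S2set [simp]: "s \<in> S2set \<Longrightarrow> t \<in> S2set \<Longrightarrow> splus s t \<in> S2set"
  and sscale_in_S2set [simp]: "s \<in> S2set \<Longrightarrow> sscale a s \<in> S2set"
  and szero_in_S2set [simp]: "szero \<in> S2set"
  by (simp_all add: S2set_def splus_def sscale_def szero_def)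

lemma sact_eq:
  "sact g s x = (\<Sum>I\<in>Pidx. \<Sum>J\<in>Pidx. if I = J \<or> plex I J
     then s (I, J) * smul (wact g (Wbas I)) (wact g (Wbas J)) x else 0)"
proof -
  have "{(I, J). I \<in> Pidx \<and> J \<in> Pidx \<and> (I = J \<or> plex I J)} = (SIGMA I:Pidx. {J \<in> Pidx. I = J \<or> plex I J})"
    by auto
  then show ?thesis
    unfolding sact_def by (simp add: sum.Sigma[symmetric] sum.If_cases Int_def cong: sum.cong)
qed

lemma smul_expand:
  assumes "a \<in> Wset" "b \<in> Wset"
  shows "smul (wact g a) (wact g b) x = (\<Sum>I\<in>Pidx. \<Sum>J\<in>Pidx. wco a I * wco b J * smul (wact g (Wbas I)) (wact g (Wbas J)) x)"
proof -
  obtain K L where x: "x = (K, L)" by (cases x)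
  show ?thesis
  proof (cases "K \<in> Pidx \<and> L \<in> Pidx")
    case True
    then show ?thesis
      by (simp add: x smul_def wco_wact_expand[OF assms(1)] wco_wact_expand[OF assms(2)] sum_product
          sum.distrib[symmetric] distrib_left mult_ac)
  next
    case False
    then show ?thesis by (auto simp: x smul_def)
  qed
qed

text \<open>The definition of \<open>sact\<close> runs over ordered index pairs only. Since
  \<open>G\<close> is symmetric, the two terms of an off-diagonal coefficient of
  \<open>smul a b\<close> restore the full double sum of the bilinear expansion.\<close>

lemma sact_smul:
  assumes "a \<in> Wset" "b \<in> Wset"
  shows "sact g (smul a b) = smul (wact g a) (wact g b)"
proof
  fix x
  define G where "G I J = smul (wact g (Wbas I)) (wact g (Wbas J)) x" for I J
  have G: "G I J = G J I" for I J by (simp add: G_def smul_commute)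
  have "(\<Sum>I\<in>Pidx. \<Sum>J\<in>Pidx. if I = J \<or> plex I J then smul a b (I, J) * G I J else 0)
      = (\<Sum>I\<in>Pidx. \<Sum>J\<in>Pidx. wco a I * wco b J * G I J)"
    unfolding sum_Pidx
    by (simp add: smul_def Pidx_eq plex_def less_4 not_less_4 algebra_simps G)
  then show "sact g (smul a b) x = smul (wact g a) (wact g b) x"
    by (simp only: sact_eq smul_expand[OF assms] G_def)
qed

lemma sact_splus: "sact g (splus s t) = splus (sact g s) (sact g t)"
  by (auto simp: fun_eq_iff splus_def sact_eq sum.distrib[symmetric] algebra_simps intro!: sum.cong)

lemma sact_sscale: "sact g (sscale a s) = sscale a (sact g s)"
  by (auto simp: fun_eq_iff sscale_def sact_eq sum_distrib_left algebra_simps intro!: sum.cong)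

lemma sact_szero [simp]: "sact g szero = szero"
  by (simp add: fun_eq_iff szero_def sact_eq cong: if_cong)

lemma sact_sum: "sact g (\<lambda>x. \<Sum>i\<in>A. f i x) = (\<lambda>x. \<Sum>i\<in>A. sact g (f i) x)"
proof (induction A rule: infinite_finite_induct)
  case (insert i A)
  then show ?case using sact_splus[of g "f i" "\<lambda>x. \<Sum>i\<in>A. f i x"] by (simp add: splus_def)
qed (use sact_szero[of g] in \<open>simp_all add: szero_def\<close>)

lemma S2set_sum: "(\<And>i. i \<in> A \<Longrightarrow> f i \<in> S2set) \<Longrightarrow> (\<lambda>x. \<Sum>i\<in>A. f i x) \<in> S2set"
  by (simp add: S2set_def)

lemma sact_as_sum:
  "sact g s = (\<lambda>x. \<Sum>I\<in>Pidx. \<Sum>J\<in>Pidx.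
     sscale (if I = J \<or> plex I J then s (I, J) else 0) (smul (wact g (Wbas I)) (wact g (Wbas J))) x)"
  by (auto simp: fun_eq_iff sact_eq sscale_def intro!: sum.cong)

lemma sact_in_S2set [simp]: "sact g s \<in> S2set"
  unfolding sact_as_sum by (intro S2set_sum) simp

text \<open>Both sides are linear combinations of images of products of basis bivectors, where
  \<open>sact_smul\<close> reduces the claim to \<open>wact_mult\<close>.\<close>

lemma sact_mult: "sact (g ** h) s = sact h (sact g s)"
  by (simp only: sact_as_sum[of g] sact_as_sum[of "g ** h"] sact_sum sact_sscale sact_smul
      Wbas_in_Wset wact_in_Wset wact_mult)

lemma smul_Wbas:
  assumes "I \<in> Pidx" "J \<in> Pidx"
  shows "smul (Wbas I) (Wbas J) (K, L) = (if (K, L) = (I, J) \<or> (K, L) = (J, I) then 1 else 0)"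
  using assms by (auto simp: smul_def wco_Wbas simp del: wco_pair)

lemma S2set_sym: "s \<in> S2set \<Longrightarrow> s (J, I) = s (I, J)"
  and S2set_outside: "s \<in> S2set \<Longrightarrow> I \<notin> Pidx \<or> J \<notin> Pidx \<Longrightarrow> s (I, J) = 0"
  unfolding S2set_def by blast+

lemma S2set_eqI:
  assumes "s \<in> S2set" "t \<in> S2set" "\<And>I J. I \<in> Pidx \<Longrightarrow> J \<in> Pidx \<Longrightarrow> s (I, J) = t (I, J)"
  shows "s = t"
proof
  fix x :: "(4 \<times> 4) \<times> (4 \<times> 4)"
  obtain I J where "x = (I, J)" by (cases x)
  then show "s x = t x"
    using assms S2set_outside[of s I J] S2set_outside[of t I J] by (cases "I \<in> Pidx \<and> J \<in> Pidx") auto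
qed

lemma plex_asym: "plex I J \<Longrightarrow> \<not> plex J I \<and> I \<noteq> J"
  by (auto simp: plex_def)

lemma plex_linear: "I = J \<or> plex I J \<or> plex J I"
  by (cases I; cases J) (auto simp: plex_def)

text \<open>At a position with \<open>K = L\<close> or \<open>plex K L\<close> only the summand for
  \<open>(K, L)\<close> itself survives, because \<open>plex\<close> admits one of the two orders of
  each monomial. Symmetry of the stored coefficients gives the remaining positions.\<close>

lemma sact_one [simp]:
  assumes s: "s \<in> S2set"
  shows "sact (mat 1) s = s"
proof (rule S2set_eqI[OF sact_in_S2set s])
  have up: "sact (mat 1) s (K, L) = s (K, L)" if KL: "K \<in> Pidx" "L \<in> Pidx" "K = L \<or> plex K L" for K L
  proof -
    have "(if I = J \<or> plex I J then s (I, J) * smul (Wbas I) (Wbas J) (K, L) else 0)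
        = (if J = L then if I = K then s (K, L) else 0 else 0)" if "I \<in> Pidx" "J \<in> Pidx" for I J
    proof (cases "I = K \<and> J = L")
      case True
      then show ?thesis using KL by (auto simp: smul_Wbas)
    next
      case False
      then have "\<not> (J = L \<and> I = K)" by blast
      moreover have "\<not> (I = L \<and> J = K \<and> (I = J \<or> plex I J))"
        using KL False plex_asym[of K L] by blast
      ultimately show ?thesis using that False by (auto simp: smul_Wbas simp del: prod.collapse)
    qed
    then have "sact (mat 1) s (K, L) = (\<Sum>I\<in>Pidx. \<Sum>J\<in>Pidx. if J = L then if I = K then s (K, L) else 0 else 0)"
      unfolding sact_eq wact_one by (intro sum.cong refl)
    then show ?thesis using KL by simp
  qed
  show "sact (mat 1) s (K, L) = s (K, L)" if "K \<in> Pidx" "L \<in> Pidx" for K L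
    using up[of K L] up[of L K] plex_linear[of K L] that S2set_sym[OF s, of K L]
      S2set_sym[OF sact_in_S2set, of "mat 1" s K L]
    by auto
qed

lemma vector_4 [simp]:
  "(vector [x, y, z, w] :: 'a::zero ^ 4) $ 1 = x"
  "(vector [x, y, z, w] :: 'a ^ 4) $ 2 = y"
  "(vector [x, y, z, w] :: 'a ^ 4) $ 3 = z"
  "(vector [x, y, z, w] :: 'a ^ 4) $ 4 = w"
  by (simp_all add: vector_def)

text \<open>Disjoint pairs from \<open>Pidx\<close> partition the four indices, so this is the
  support of the pairing of basis bivectors under \<open>chi4\<close> and also the support of
  \<open>U\<close>.\<close>

definition opp :: "4 \<times> 4 \<Rightarrow> 4 \<times> 4 \<Rightarrow> bool" where
  "opp I J \<longleftrightarrow> {fst I, snd I} \<inter> {fst J, snd J} = {}"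

section \<open>Inverses in \<open>SL_4\<close> and invariance of the dual pairings\<close>

lemma SL4_inverse:
  fixes g :: "'a::field mat4"
  assumes "g \<in> SL4"
  shows "g ** matrix_inv g = mat 1" "matrix_inv g ** g = mat 1" "matrix_inv g \<in> SL4"
proof -
  have "invertible g"
    using assms by (simp add: invertible_det_nz SL4_def)
  then have "\<exists>h. g ** h = mat 1 \<and> h ** g = mat 1"
    by (simp add: invertible_def)
  from someI_ex[OF this] show 1: "g ** matrix_inv g = mat 1" and "matrix_inv g ** g = mat 1"
    by (simp_all add: matrix_inv_def)
  from 1 have "det g * det (matrix_inv g) = 1"
    by (metis det_mul det_I)
  with assms show "matrix_inv g \<in> SL4" by (simp add: SL4_def)
qed

lemma SL4_mult: "g \<in> SL4 \<Longrightarrow> h \<in> SL4 \<Longrightarrow> g ** h \<in> SL4"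
  and SL4_one [simp]: "mat 1 \<in> SL4"
  by (simp_all add: SL4_def det_mul det_I)

lemma pair_act:
  assumes "g \<in> SL4"
  shows "pair (dact g f) (vact g v) = pair f v"
proof -
  have "pair (dact g f) (vact g v) = (\<Sum>i\<in>UNIV. (\<Sum>k\<in>UNIV. matrix_inv g $ i $ k * f $ k) * (\<Sum>l\<in>UNIV. g $ l $ i * v $ l))"
    by (simp add: pair_def dact_def vact_def matrix_vector_mult_def vector_matrix_mult_def mult.commute)
  also have "\<dots> = (\<Sum>k\<in>UNIV. \<Sum>l\<in>UNIV. f $ k * v $ l * (g ** matrix_inv g) $ l $ k)"
    by (simp add: matrix_matrix_mult_def sum_4 algebra_simps)
  also have "\<dots> = (\<Sum>k\<in>UNIV. f $ k * v $ k)"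
    by (simp add: SL4_inverse[OF assms] mat_def if_distrib[of "\<lambda>x. _ * x"] cong: if_cong)
  finally show ?thesis by (simp add: pair_def)
qed

lemma dwedge_eq: "dwedge f g A = (\<Sum>I\<in>Pidx. wco A I * wco (wedge f g) I)"
  by (simp add: dwedge_def wco_def)

lemma dwedge_wedge: "dwedge f g (wedge v w) = pair f v * pair g w - pair f w * pair g v"
  by (simp add: dwedge_eq sum_Pidx pair_def sum_4 algebra_simps)

text \<open>On decomposable bivectors both sides are 2 by 2 determinants of pairings, invariant by
  \<open>pair_act\<close>; the basis bivectors are decomposable, and linearity does the
  rest.\<close>

lemma dwedge_act:
  assumes g: "g \<in> SL4" and A: "A \<in> Wset"
  shows "dwedge (dact g f) (dact g h) (wact g A) = dwedge f h A"
proof -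
  have 1: "dwedge (dact g f) (dact g h) (wact g (Wbas I)) = dwedge f h (Wbas I)" for I
    unfolding Wbas_def wact_wedge dwedge_wedge using pair_act[OF g] by (simp add: vact_def)
  have 2: "dwedge f h (Wbas I) = wco (wedge f h) I" if "I \<in> Pidx" for I
  proof -
    have "dwedge f h (Wbas I) = (\<Sum>J\<in>Pidx. if J = I then wco (wedge f h) J else 0)"
      unfolding dwedge_eq using that by (intro sum.cong refl) (auto simp: wco_Wbas simp del: wco_pair)
    then show ?thesis using that by simp
  qed
  have "dwedge (dact g f) (dact g h) (wact g A)
      = (\<Sum>I\<in>Pidx. wco A I * dwedge (dact g f) (dact g h) (wact g (Wbas I)))"
    unfolding dwedge_eq wco_wact_expand[OF A] sum_distrib_left sum_distrib_right mult.assoc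
    by (rule sum.swap)
  also have "\<dots> = (\<Sum>I\<in>Pidx. wco A I * wco (wedge f h) I)"
    unfolding 1 by (intro sum.cong refl arg_cong2[where f = "(*)"]) (rule 2)
  finally show ?thesis by (simp add: dwedge_eq)
qed

lemma sum_swap3:
  "(\<Sum>i\<in>A. \<Sum>j\<in>B. \<Sum>k\<in>C. f i j k) = (\<Sum>k\<in>C. \<Sum>i\<in>A. \<Sum>j\<in>B. f i j k)"
proof -
  have "(\<Sum>i\<in>A. \<Sum>j\<in>B. \<Sum>k\<in>C. f i j k) = (\<Sum>i\<in>A. \<Sum>k\<in>C. \<Sum>j\<in>B. f i j k)"
    by (intro sum.cong refl sum.swap)
  also have "\<dots> = (\<Sum>k\<in>C. \<Sum>i\<in>A. \<Sum>j\<in>B. f i j k)"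
    by (rule sum.swap)
  finally show ?thesis .
qed

section \<open>Invariance of U and of the voltages in characteristic 2\<close>

locale char_two =
  fixes c :: "'a::field"
  assumes char2: "CHAR('a) = 2" and c_nz: "c \<noteq> 0"
begin

lemma add_self [simp]: "x + x = (0::'a)"
proof -
  have "(2::'a) = 0" using of_nat_CHAR[where 'a = 'a] char2 by simp
  then show ?thesis by (metis mult_2 mult_zero_left)
qed

lemma add_left_self [simp]: "x + (x + y) = (y::'a)"
  by (simp flip: add.assoc)

lemma minus_eq [simp]: "- x = (x::'a)"
  by (metis add_self add_eq_0_iff)

lemma diff_eq [simp]: "x - y = x + (y::'a)"
  by (simp only: diff_conv_add_uminus minus_eq)

text \<open>The signs of the three terms disappear in characteristic 2, and each of the three
  monomials is stored at two positions.\<close>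

lemma Uel_apply: "Uel c (I, J) = (if I \<in> Pidx \<and> J \<in> Pidx \<and> opp I J then inverse c else 0)"
proof -
  have "\<forall>I\<in>Pidx. \<forall>J\<in>Pidx. Uel c (I, J) = (if opp I J then inverse c else 0)"
    unfolding ball_Pidx
    by (simp add: Uel_def Let_def splus_def smul_def Pidx_eq axis_def opp_def)
  moreover have "Uel c (I, J) = 0" if "I \<notin> Pidx \<or> J \<notin> Pidx"
    using that by (auto simp: Uel_def Let_def splus_def smul_def)
  ultimately show ?thesis by (cases "I \<in> Pidx \<and> J \<in> Pidx") auto
qed

lemma Uel_in_S2set [simp]: "Uel c \<in> S2set"
  by (auto simp: S2set_def Uel_apply opp_def)

text \<open>In this form \<open>sact_smul\<close> and \<open>wact_Wbas\<close> express the image of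
  \<open>U\<close> through the rows of \<open>g\<close>.\<close>

lemma Uel_as_smul: "Uel c = sscale (inverse c) (splus (splus
    (smul (Wbas (1,2)) (Wbas (3,4))) (smul (Wbas (1,3)) (Wbas (4,2)))) (smul (Wbas (1,4)) (Wbas (2,3))))"
  by (auto simp: Uel_def Let_def fun_eq_iff splus_def sscale_def smul_def Wbas_def algebra_simps)

text \<open>The coefficient of the image at a complementary pair is the Laplace expansion of
  \<open>det g\<close> along two columns. If the pairs share one index it is the expansion of a
  determinant with a repeated column, and on the diagonal it is a Pluecker relation.\<close>

lemma sact_Uel:
  assumes g: "g \<in> SL4"
  shows "sact g (Uel c) = Uel c"
proof -
  have D: "det g = 1" using g by (simp add: SL4_def)
  let ?s = "splus (splus (smul (wedge (g$1) (g$2)) (wedge (g$3) (g$4))) (smul (wedge (g$1) (g$3)) (wedge (g$4) (g$2))))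
     (smul (wedge (g$1) (g$4)) (wedge (g$2) (g$3)))"
  have eq: "sact g (Uel c) = sscale (inverse c) ?s"
    by (simp add: Uel_as_smul sact_sscale sact_splus sact_smul wact_Wbas)
  have "\<forall>I\<in>Pidx. \<forall>J\<in>Pidx. ?s (I, J) = (if opp I J then det g else 0)"
    unfolding ball_Pidx
    by (simp add: splus_def smul_def Pidx_eq opp_def det_4 algebra_simps)
  then have "sact g (Uel c) (I, J) = Uel c (I, J)" if "I \<in> Pidx" "J \<in> Pidx" for I J
    using that D by (simp add: eq sscale_def Uel_apply)
  then show ?thesis by (intro S2set_eqI) simp_all
qed

section \<open>The form on \<open>W\<close>, the Hodge star and equivariance of the voltages\<close>

lemma chi4_axis:
  assumes "I \<in> Pidx" "J \<in> Pidx"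
  shows "chi4 c (axis (fst I) 1) (axis (snd I) 1) (axis (fst J) 1) (axis (snd J) 1) = (if opp I J then c else 0)"
proof -
  have "\<forall>I\<in>Pidx. \<forall>J\<in>Pidx. chi4 c (axis (fst I) 1) (axis (snd I) 1) (axis (fst J) 1) (axis (snd J) 1)
     = (if opp I J then c else 0)"
    unfolding ball_Pidx by (simp add: chi4_def det_4 axis_def opp_def)
  then show ?thesis using assms by blast
qed

lemma chiW_eq: "chiW c A B = (\<Sum>I\<in>Pidx. \<Sum>J\<in>Pidx. wco A I * wco B J * (if opp I J then c else 0))"
  unfolding chiW_def by (intro sum.cong refl) (simp add: chi4_axis)

text \<open>For basis bivectors the value is \<open>c\<close> times the Laplace expansion of the
  determinant with rows of \<open>g\<close> indexed by \<open>I\<close> and \<open>J\<close>: it is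
  \<open>det g\<close> for complementary pairs and has repeated rows otherwise. Bilinearity extends
  this to \<open>Wset\<close>.\<close>

lemma chiW_act:
  assumes g: "g \<in> SL4" and AB: "A \<in> Wset" "B \<in> Wset"
  shows "chiW c (wact g A) (wact g B) = chiW c A B"
proof -
  have D: "det g = 1" using g by (simp add: SL4_def)
  have "\<forall>I\<in>Pidx. \<forall>J\<in>Pidx. chiW c (wact g (Wbas I)) (wact g (Wbas J)) = (if opp I J then c * det g else 0)"
    unfolding ball_Pidx
    by (simp add: chiW_eq sum_Pidx opp_def wact_Wbas det_4 algebra_simps)
  then have 1: "chiW c (wact g (Wbas I)) (wact g (Wbas J)) = (if opp I J then c else 0)"
    if "I \<in> Pidx" "J \<in> Pidx" for I J
    using that D by simp
  let ?f = "\<lambda>K L I J. wco A I * wco B J * (wco (wact g (Wbas I)) K * wco (wact g (Wbas J)) L * (if opp K L then c else 0))"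
  have "chiW c (wact g A) (wact g B) = (\<Sum>K\<in>Pidx. \<Sum>L\<in>Pidx. \<Sum>I\<in>Pidx. \<Sum>J\<in>Pidx. ?f K L I J)"
    unfolding chiW_eq wco_wact_expand[OF AB(1)] wco_wact_expand[OF AB(2)]
    by (intro sum.cong refl) (subst sum_product, simp only: sum_distrib_left mult_ac)
  also have "\<dots> = (\<Sum>I\<in>Pidx. \<Sum>J\<in>Pidx. \<Sum>K\<in>Pidx. \<Sum>L\<in>Pidx. ?f K L I J)"
    by (rule trans[OF sum_swap3 sum.cong[OF refl sum_swap3]])
  also have "\<dots> = (\<Sum>I\<in>Pidx. \<Sum>J\<in>Pidx. wco A I * wco B J * chiW c (wact g (Wbas I)) (wact g (Wbas J)))"
    by (simp only: chiW_eq sum_distrib_left)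
  also have "\<dots> = chiW c A B"
    unfolding chiW_eq[of A B] by (intro sum.cong refl) (simp only: 1)
  finally show ?thesis .
qed

text \<open>The usual signs of the Hodge star are absent in characteristic 2.\<close>
definition hodge :: "'a mat4 \<Rightarrow> 'a mat4" where
  "hodge A = (\<chi> i j. inverse c * (vector [vector [0, A$3$4, A$2$4, A$2$3], vector [A$3$4, 0, A$1$4, A$1$3],
     vector [A$2$4, A$1$4, 0, A$1$2], vector [A$2$3, A$1$3, A$1$2, 0]] :: 'a mat4) $ i $ j)"

lemma mult_inverse_c [simp]: "c * (inverse c * x) = x"
  using c_nz by (simp flip: mult.assoc)

text \<open>Pairing with a basis bivector reads off the complementary coordinate times
  \<open>c\<close>. This gives the uniqueness behind the description operator in
  \<open>phi\<close>.\<close>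

lemma psi_inj:
  assumes "A \<in> Wset" "B \<in> Wset" "psi c A = psi c B"
  shows "A = B"
proof (rule Wset_eqI[OF assms(1,2)])
  have "\<forall>I\<in>Pidx. chiW c (Wbas I) A = chiW c (Wbas I) B"
    using assms(3) by (metis psi_def)
  then have "\<forall>I\<in>Pidx. wco A I = wco B I"
    unfolding ball_Pidx using c_nz by (simp add: chiW_eq sum_Pidx opp_def Wbas_def axis_def)
  then show "I \<in> Pidx \<Longrightarrow> wco A I = wco B I" for I by blast
qed

lemma phi_psi: "B \<in> Wset \<Longrightarrow> phi c (psi c B) = B"
  unfolding phi_def by (rule the_equality) (auto intro: psi_inj)

lemma hodge_in_Wset: "hodge A \<in> Wset"
  by (simp add: Wset_def hodge_def forall_4)

lemma psi_hodge: "psi c (hodge (wedge f g)) = dwedge f g"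
  using c_nz by (simp add: fun_eq_iff psi_def dwedge_eq chiW_eq sum_Pidx opp_def hodge_def algebra_simps)

lemma phi_dwedge: "phi c (dwedge f g) = hodge (wedge f g)"
  by (metis phi_psi psi_hodge hodge_in_Wset)

lemma phi_dwedge_in_Wset [simp]: "phi c (dwedge f g) \<in> Wset"
  by (simp add: phi_dwedge hodge_in_Wset)

lemma psi_phi_dwedge: "psi c (phi c (dwedge f g)) = dwedge f g"
  by (simp add: phi_dwedge psi_hodge)

text \<open>Invariance of \<open>chiW\<close> and of \<open>dwedge\<close> shows that both sides
  have the same image under the injective map \<open>psi c\<close>.\<close>

lemma phi_dwedge_act:
  assumes g: "g \<in> SL4"
  shows "phi c (dwedge (dact g f) (dact g h)) = wact g (phi c (dwedge f h))"
proof -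
  let ?B = "phi c (dwedge f h)"
  have "psi c (wact g ?B) A = dwedge (dact g f) (dact g h) A" for A
  proof -
    \<comment> \<open>Equality of functionals is needed at every matrix \<open>A\<close>, but they
      see only the entries in \<open>Pidx\<close>. So \<open>A\<close> is replaced by the
      alternating matrix \<open>A0\<close> with these entries, and \<open>A1\<close> is its preimage
      under the action of \<open>g\<close>.\<close>
    define A0 where "A0 = (\<chi> i j. if i < j then A $ i $ j else if j < i then - A $ j $ i else 0)"
    have A0: "A0 \<in> Wset" by (auto simp: A0_def Wset_def)
    define A1 where "A1 = wact (matrix_inv g) A0"
    have A1: "A1 \<in> Wset" "wact g A1 = A0"
      using A0 by (simp_all add: A1_def flip: wact_mult) (simp add: SL4_inverse[OF g])
    have co: "wco A I = wco A0 I" if "I \<in> Pidx" for I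
      using that by (auto simp: A0_def Pidx_def)
    have "psi c (wact g ?B) A = chiW c (wact g A1) (wact g ?B)"
      unfolding psi_def chiW_eq A1(2) by (intro sum.cong refl) (simp only: co)
    also have "\<dots> = psi c ?B A1"
      unfolding psi_def by (intro chiW_act g A1(1)) simp
    also have "\<dots> = dwedge (dact g f) (dact g h) (wact g A1)"
      by (simp only: psi_phi_dwedge dwedge_act[OF g A1(1)])
    also have "\<dots> = dwedge (dact g f) (dact g h) A"
      unfolding dwedge_eq A1(2) by (intro sum.cong refl) (simp only: co)
    finally show ?thesis .
  qed
  then have "psi c (wact g ?B) = dwedge (dact g f) (dact g h)" by auto
  then show ?thesis by (metis phi_psi phi_dwedge_in_Wset wact_in_Wset)
qed

lemma ell_act:
  assumes "g \<in> SL4"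
  shows "ell c (vact g v) (dact g f) (vact g w) (dact g h) = sact g (ell c v f w h)"
  by (simp add: ell_def pair_act phi_dwedge_act assms sact_sscale sact_smul wact_wedge vact_def[symmetric])

lemma ell_in_S2set [simp]: "ell c v f w h \<in> S2set"
  by (simp add: ell_def)


section \<open>The potential\<close>

lemma splus_assoc: "splus (splus s t) u = splus s (splus t u)"
  and splus_commute: "splus s t = splus t s"
  and splus_left_commute: "splus s (splus t u) = splus t (splus s u)"
  for s t u :: "'a S2"
  by (simp_all add: splus_def fun_eq_iff add_ac)

lemmas splus_ac = splus_assoc splus_commute splus_left_commute

lemma splus_self [simp]: "splus s s = (szero :: 'a S2)"
  and splus_left_self [simp]: "splus s (splus s t) = (t :: 'a S2)"
  and splus_szero [simp]: "splus s szero = (s :: 'a S2)" "splus szero s = s"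
  by (simp_all add: splus_def szero_def fun_eq_iff)

lemma sminus_eq: "sminus s t = splus s (t :: 'a S2)"
  by (simp add: splus_def sminus_def)

lemma Ncl_eq: "Ncl c s = {s, splus s (Uel c)}"
  unfolding Ncl_def Setcompr_eq_image by simp

lemma Ncl_eq_iff: "Ncl c s = Ncl c t \<longleftrightarrow> t = s \<or> t = splus s (Uel c)"
proof
  assume "Ncl c s = Ncl c t"
  then have "t \<in> Ncl c s" by (simp add: Ncl_eq)
  then show "t = s \<or> t = splus s (Uel c)" by (auto simp: Ncl_eq)
qed (auto simp: Ncl_eq splus_ac)

lemma nadd_Ncl: "nadd (Ncl c s) (Ncl c t) = Ncl c (splus s t)"
  by (auto simp: nadd_def Ncl_eq splus_ac intro: exI[of _ s] exI[of _ t])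

lemma nsub_Ncl: "nsub (Ncl c s) (Ncl c t) = Ncl c (splus s t)"
  using nadd_Ncl by (simp add: nsub_def nadd_def sminus_eq)

lemma nact_Ncl: "g \<in> SL4 \<Longrightarrow> nact g (Ncl c s) = Ncl c (sact g s)"
  by (auto simp: nact_def Ncl_eq sact_splus sact_Uel)

text \<open>In characteristic 2 the cross terms of a square cancel, so vanishing off the diagonal
  describes the \<open>F\<close>-span of all squares, whatever the basis.\<close>

definition SQ :: "'a S2 set" where
  "SQ = {s \<in> S2set. \<forall>I J. I \<noteq> J \<longrightarrow> s (I, J) = 0}"

text \<open>The full preimage in \<open>S_2(W)\<close> of the image of \<open>SQ\<close> in
  \<open>N\<close>.\<close>

definition SQU :: "'a S2 set" where
  "SQU = SQ \<union> (\<lambda>s. splus s (Uel c)) ` SQ"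

lemma SQ_in_S2set: "s \<in> SQ \<Longrightarrow> s \<in> S2set"
  and szero_in_SQ [simp]: "szero \<in> SQ"
  and splus_in_SQ: "s \<in> SQ \<Longrightarrow> t \<in> SQ \<Longrightarrow> splus s t \<in> SQ"
  by (simp_all add: SQ_def) (simp_all add: splus_def szero_def)

lemma SQU_in_S2set: "s \<in> SQU \<Longrightarrow> s \<in> S2set"
  by (auto simp: SQU_def SQ_in_S2set)

lemma SQ_in_SQU: "s \<in> SQ \<Longrightarrow> s \<in> SQU"
  by (simp add: SQU_def)

lemma SQU_iff: "s \<in> SQU \<longleftrightarrow> s \<in> SQ \<or> splus s (Uel c) \<in> SQ"
  by (auto simp: SQU_def splus_ac image_iff intro!: bexI[of _ "splus s (Uel c)"])

lemma splus_in_SQU: "s \<in> SQU \<Longrightarrow> t \<in> SQU \<Longrightarrow> splus s t \<in> SQU"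
proof -
  assume "s \<in> SQU" "t \<in> SQU"
  then obtain s' t' where st: "s' \<in> SQ" "t' \<in> SQ" "s = s' \<or> s = splus s' (Uel c)" "t = t' \<or> t = splus t' (Uel c)"
    unfolding SQU_def by blast
  then have "splus s t = splus s' t' \<or> splus s t = splus (splus s' t') (Uel c)"
    by (auto simp: splus_ac)
  then show ?thesis using splus_in_SQ[OF st(1,2)] unfolding SQU_def by auto
qed

lemma Uel_in_SQU [simp]: "Uel c \<in> SQU"
  by (simp add: SQU_iff)

lemma szero_in_SQU [simp]: "szero \<in> SQU"
  by (simp add: SQ_in_SQU)

text \<open>In characteristic 0, \<open>v \<otimes> f \<mapsto> 1/2 \<Sum>\<^sub>i (v \<and> e\<^sub>i)(\<phi>(f \<and> e\<^sub>i*))\<close> would be a potential in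
  \<open>\<Lambda>\<^sup>2W\<close>, which is \<open>sl(V)\<close>. On tensors of trace 1, half of \<open>U\<close> can be subtracted from it to
  clear the denominator, and the reduction modulo 2 is the following map (divided by \<open>c\<close>). The index 1 is
  distinguished because the trace condition has been used to eliminate \<open>T $ 1 $ 1\<close>.\<close>
definition lin_pot :: "'a mat4 \<Rightarrow> 'a S2" where
  "lin_pot T = (\<lambda>(I, J). if I \<in> Pidx \<and> J \<in> Pidx \<and> I \<noteq> J then
     (if opp I J then \<Sum>m\<in>UNIV.
         if m \<in> (if fst I = 1 \<or> snd I = 1 then {fst J, snd J} else {fst I, snd I}) then T $ m $ m else 0
      else \<Sum>a\<in>UNIV. \<Sum>b\<in>UNIV. if (a = fst I \<or> a = snd I) \<and> (a = fst J \<or> a = snd J)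
         \<and> b \<noteq> fst I \<and> b \<noteq> snd I \<and> b \<noteq> fst J \<and> b \<noteq> snd J then T $ a $ b else 0) else 0)"

definition pot :: "'a mat4 \<Rightarrow> 'a S2" where
  "pot T = sscale (inverse (c * trace T)) (lin_pot T)"

lemma lin_pot_in_S2set: "lin_pot T \<in> S2set"
proof -
  have "\<forall>I\<in>Pidx. \<forall>J\<in>Pidx. lin_pot T (I, J) = lin_pot T (J, I)"
    unfolding ball_Pidx by (simp add: lin_pot_def Pidx_eq opp_def sum_4)
  moreover have "lin_pot T (I, J) = 0" if "I \<notin> Pidx \<or> J \<notin> Pidx" for I J
    using that by (auto simp: lin_pot_def)
  ultimately show ?thesis
    unfolding S2set_def by (auto; metis)
qed

lemma pot_in_S2set [simp]: "pot T \<in> S2set"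
  by (simp add: pot_def lin_pot_in_S2set)

text \<open>If the pairs share \<open>a\<close> and both miss \<open>b\<close>, the coefficient is
  the \<open>(a, b)\<close> entry of the matrix product \<open>R\<close>, up to
  \<open>inverse c\<close>. For complementary pairs, the two diagonal entries in
  \<open>lin_pot\<close> sum the four coordinate products that mix \<open>I\<close> with
  \<open>J\<close>; adding the full pairing leaves exactly those at \<open>I\<close> and
  \<open>J\<close>.\<close>

lemma smul_hodge:
  assumes A: "A \<in> Wset" and B: "B \<in> Wset"
    and R: "\<And>a b. (\<Sum>m\<in>UNIV. A $ a $ m * B $ m $ b) = R $ a $ b"
    and IJ: "I \<in> Pidx" "J \<in> Pidx" "I \<noteq> J"
  shows "smul A (hodge B) (I, J) = inverse c * (lin_pot R (I, J) + (if opp I J then \<Sum>I\<in>Pidx. wco A I * wco B I else 0))"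
proof -
  have "\<forall>I\<in>Pidx. \<forall>J\<in>Pidx. I \<noteq> J \<longrightarrow>
      smul A (hodge B) (I, J) = inverse c * (lin_pot R (I, J) + (if opp I J then \<Sum>I\<in>Pidx. wco A I * wco B I else 0))"
    unfolding ball_Pidx
    by (simp add: smul_def lin_pot_def Pidx_eq opp_def sum_4 hodge_def Wset_coords[OF A] Wset_coords[OF B] algebra_simps flip: R)
  then show ?thesis using IJ by blast
qed

lemma trace_tens: "trace (tens v f) = pair f v"
  by (simp add: trace_def tens_def pair_def mult.commute)

lemma lin_pot_comb: "lin_pot (\<chi> i j. a * T $ i $ j + b * S $ i $ j) x = a * lin_pot T x + b * lin_pot S x"
proof -
  obtain I J where x: "x = (I, J)" by (cases x)
  have 1: "(if P then (\<chi> i j. a * T $ i $ j + b * S $ i $ j) $ k $ l else 0)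
      = a * (if P then T $ k $ l else 0) + b * (if P then S $ k $ l else 0)" for P k l by simp
  show ?thesis unfolding x lin_pot_def prod.case 1 sum.distrib sum_distrib_left[symmetric] by simp
qed

text \<open>Each edge voltage is the sum of the potentials of its ends, up to \<open>U\<close> and
  squares. Off the diagonal the voltage depends only on the product of the matrices
  \<open>wedge v w\<close> and \<open>wedge f g\<close>, which orthogonality splits into a part from
  each end.\<close>

lemma ell_plus_pot:
  assumes "pair f v \<noteq> 0" "pair g w \<noteq> 0" "pair f w = 0" "pair g v = 0"
  shows "splus (ell c v f w g) (splus (pot (tens v f)) (pot (tens w g))) \<in> SQU"
proof -
  define p q where "p = pair f v" and "q = pair g w"
  define A B where "A = wedge v w" and "B = wedge f g"
  \<comment> \<open>\<open>R\<close> is that matrix product: its other two terms carry the factors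
    \<open>pair f w\<close> and \<open>pair g v\<close>.\<close>
  define R where "R = (\<chi> i j. q * tens v f $ i $ j + p * tens w g $ i $ j)"
  have "(\<Sum>m\<in>UNIV. A $ a $ m * B $ m $ b) =
     v $ a * g $ b * pair f w + v $ a * f $ b * q + w $ a * g $ b * p + w $ a * f $ b * pair g v" for a b
    by (simp add: A_def B_def p_def q_def pair_def sum_4 algebra_simps)
  then have R: "(\<Sum>m\<in>UNIV. A $ a $ m * B $ m $ b) = R $ a $ b" for a b
    by (simp add: assms R_def tens_def algebra_simps)
  have pq: "(\<Sum>I\<in>Pidx. wco A I * wco B I) = p * q"
    using dwedge_wedge[of f g v w] assms by (simp add: dwedge_eq A_def B_def p_def q_def)
  let ?s = "splus (ell c v f w g) (splus (pot (tens v f)) (pot (tens w g)))"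
  \<comment> \<open>The constant \<open>p * q\<close> at complementary pairs becomes
    \<open>inverse c\<close> after normalisation, which is the coefficient of \<open>U\<close>
    there. So adding \<open>U\<close> clears everything off the diagonal.\<close>
  have "splus ?s (Uel c) (I, J) = 0" if "I \<noteq> J" for I J
  proof (cases "I \<in> Pidx \<and> J \<in> Pidx")
    case True
    have nz: "p \<noteq> 0" "q \<noteq> 0" using assms by (simp_all add: p_def q_def)
    have "ell c v f w g (I, J) = inverse p * inverse q * smul A (hodge B) (I, J)"
      by (simp add: ell_def sscale_def phi_dwedge A_def B_def p_def q_def)
    also have "smul A (hodge B) (I, J) = inverse c * (lin_pot R (I, J) + (if opp I J then p * q else 0))"
      using smul_hodge[of A B R I J] R pq True that by (simp add: A_def B_def)
    also have "lin_pot R (I, J) = q * lin_pot (tens v f) (I, J) + p * lin_pot (tens w g) (I, J)"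
      unfolding R_def by (rule lin_pot_comb)
    finally have "ell c v f w g (I, J) = inverse c * (inverse p * lin_pot (tens v f) (I, J) + inverse q * lin_pot (tens w g) (I, J)
        + (if opp I J then 1 else 0))"
      using nz by (simp add: field_simps)
    then show ?thesis using True
      by (simp add: splus_def pot_def sscale_def trace_tens Uel_apply p_def q_def algebra_simps)
  next
    case False
    have "splus ?s (Uel c) \<in> S2set" by simp
    then show ?thesis using False S2set_outside by blast
  qed
  then have "splus ?s (Uel c) \<in> SQ" unfolding SQ_def by simp
  then show ?thesis by (simp add: SQU_iff)
qed

end

section \<open>Walks in the lifted graph\<close>

lemma pair_commute: "pair f v = pair v f"
  by (simp add: pair_def mult.commute)

lemma pair_add: "pair (f + g) v = pair f v + pair g v"
  by (simp add: pair_def sum.distrib distrib_right)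

lemma pair_axis: "pair (axis i 1) v = v $ i"
  by (simp add: pair_def axis_def if_distrib[of "\<lambda>x. x * _"] cong: if_cong)

text \<open>The matrix with rows \<open>f, g, f, g\<close> is singular, and a vector in its kernel
  serves.\<close>

lemma common_kernel:
  fixes f g :: "'a::field Vd"
  obtains x where "x \<noteq> 0" "pair f x = 0" "pair g x = 0"
proof -
  let ?A = "vector [f, g, f, g] :: 'a mat4"
  have "det ?A = 0"
    by (rule det_identical_rows[of 1 3]) (simp_all add: row_def)
  then have "\<not> invertible ?A" by (simp add: invertible_det_nz)
  then have "\<not> (\<exists>B. B ** ?A = mat 1)" by (simp add: invertible_left_inverse)
  then obtain x where x: "x \<noteq> 0" "?A *v x = 0"
    unfolding matrix_left_invertible_ker by blast
  have "pair f x = (?A *v x) $ 1" "pair g x = (?A *v x) $ 2"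
    by (simp_all add: matrix_vector_mult_def pair_def)
  with x show ?thesis using that by simp
qed

text \<open>\<open>f\<close> kills \<open>x\<close> but not \<open>v\<close>, so the two are
  independent and some 2 by 2 minor of them is nonzero. That minor, as a function of its second
  vector, is the functional sought.\<close>

lemma separating_functional:
  fixes v x :: "'a::field V"
  assumes "pair f v \<noteq> 0" "pair f x = 0" "x \<noteq> 0"
  obtains h where "pair h v = 0" "pair h x \<noteq> 0"
proof -
  from \<open>x \<noteq> 0\<close> obtain i where i: "x $ i \<noteq> 0" by (auto simp: vec_eq_iff)
  have "\<exists>j. v $ j * x $ i - v $ i * x $ j \<noteq> 0"
  proof (rule ccontr)
    assume "\<not> ?thesis"
    then have "v $ j * x $ i = v $ i * x $ j" for j by simp
    then have "pair f v * x $ i = v $ i * pair f x"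
      by (simp add: pair_def sum_distrib_left sum_distrib_right mult.assoc mult.left_commute)
    with assms i show False by simp
  qed
  then obtain j where j: "v $ j * x $ i - v $ i * x $ j \<noteq> 0" ..
  have *: "pair (\<chi> k. v $ j * (if k = i then 1 else 0) - v $ i * (if k = j then 1 else 0)) y = v $ j * y $ i - v $ i * y $ j" for y
    by (simp add: pair_def left_diff_distrib sum_subtractf mult.assoc if_distrib[of "\<lambda>x. x * _"]
        flip: sum_distrib_left cong: if_cong)
  show ?thesis using that[of "\<chi> k. v $ j * (if k = i then 1 else 0) - v $ i * (if k = j then 1 else 0)"] j
    unfolding * by (simp add: mult.commute)
qed

lemma tens_nth [simp]: "tens v f $ i $ j = v $ i * f $ j"
  by (simp add: tens_def)

lemma tens_in_HV: "pair f v \<noteq> 0 \<Longrightarrow> tens v f \<in> HV"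
  by (auto simp: HV_def)

text \<open>The trace recovers \<open>pair f v\<close> from the tensor, independently of the chosen
  factors.\<close>

lemma tens_in_HV_iff: "tens v f \<in> HV \<longleftrightarrow> pair f v \<noteq> 0"
proof
  assume "tens v f \<in> HV"
  then obtain w g where "tens v f = tens w g" "pair g w \<noteq> 0" by (auto simp: HV_def)
  moreover have "trace (tens v f) = pair f v" "trace (tens w g) = pair g w"
    by (simp_all add: trace_def pair_def mult.commute)
  ultimately show "pair f v \<noteq> 0" by metis
qed (rule tens_in_HV)

text \<open>\<open>Hadj\<close> asks for some factorisation of the tensors. The matrix product of
  two tensors is \<open>pair f w\<close> times \<open>tens v g\<close>, so orthogonality can be seen
  on the tensors and holds for every factorisation.\<close>

lemma Hadj_tens_iff:
  "Hadj (tens v f) (tens w g) \<longleftrightarrow> pair f v \<noteq> 0 \<and> pair g w \<noteq> 0 \<and> pair f w = 0 \<and> pair g v = 0"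
proof
  have prod: "(tens v f ** tens w g) $ i $ k = v $ i * pair f w * g $ k" for v f w g :: "'a V" and i k
    by (simp add: matrix_matrix_mult_def pair_def sum_distrib_left sum_distrib_right mult_ac)
  have 0: "pair f w = 0" if "tens v f = tens v' f'" "tens w g = tens w' g'" "pair f' w' = 0"
    "pair f v \<noteq> 0" "pair g w \<noteq> 0" for v f w g v' f' w' g' :: "'a V"
  proof -
    have "v \<noteq> 0" "g \<noteq> 0" using that by (auto simp: pair_def)
    then obtain i k where "v $ i \<noteq> 0" "g $ k \<noteq> 0" by (auto simp: vec_eq_iff)
    moreover have "v $ i * pair f w * g $ k = v' $ i * pair f' w' * g' $ k"
      using prod[of v f w g i k] prod[of v' f' w' g' i k] that(1,2) by simp
    ultimately show ?thesis using that(3) by simp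
  qed
  assume "Hadj (tens v f) (tens w g)"
  then obtain v' f' w' g' where *: "tens v f = tens v' f'" "tens w g = tens w' g'" "pair f' w' = 0" "pair g' v' = 0"
    and nz: "pair f v \<noteq> 0" "pair g w \<noteq> 0"
    unfolding Hadj_def tens_in_HV_iff by blast
  show "pair f v \<noteq> 0 \<and> pair g w \<noteq> 0 \<and> pair f w = 0 \<and> pair g v = 0"
    using 0[OF *(1,2,3) nz] 0[OF *(2,1,4) nz(2,1)] nz by simp
qed (auto simp: Hadj_def tens_in_HV)

text \<open>A vector killed by both functionals, with a suitable functional killing
  \<open>v\<close>, gives a common neighbour.\<close>

lemma Hadj_walk_same_vector:
  fixes v :: "'a::field V"
  assumes "pair f v \<noteq> 0" "pair g v \<noteq> 0"
  shows "Hadj\<^sup>*\<^sup>* (tens v f) (tens v g)"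
proof -
  obtain x where x: "x \<noteq> 0" "pair f x = 0" "pair g x = 0" by (rule common_kernel)
  obtain h where "pair h v = 0" "pair h x \<noteq> 0" by (rule separating_functional[OF assms(1) x(2,1)])
  then have "Hadj (tens v f) (tens x h)" "Hadj (tens x h) (tens v g)"
    using assms x by (simp_all add: Hadj_tens_iff)
  then show ?thesis by (meson converse_rtranclp_into_rtranclp r_into_rtranclp)
qed

text \<open>The dual argument, with vectors and functionals exchanged by
  \<open>pair_commute\<close>.\<close>

lemma Hadj_walk_same_functional:
  fixes v :: "'a::field V"
  assumes "pair f v \<noteq> 0" "pair f w \<noteq> 0"
  shows "Hadj\<^sup>*\<^sup>* (tens v f) (tens w f)"
proof -
  obtain h where h: "h \<noteq> 0" "pair v h = 0" "pair w h = 0" by (rule common_kernel)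
  have "pair v f \<noteq> 0" using assms(1) by (simp add: pair_commute)
  then obtain x where "pair x f = 0" "pair x h \<noteq> 0" using separating_functional h by blast
  then have "Hadj (tens v f) (tens x h)" "Hadj (tens x h) (tens w f)"
    using assms h by (simp_all add: Hadj_tens_iff) (simp_all add: pair_commute)
  then show ?thesis by (meson converse_rtranclp_into_rtranclp r_into_rtranclp)
qed

lemma Hadj_connected:
  assumes "T \<in> HV" "S \<in> HV"
  shows "Hadj\<^sup>*\<^sup>* T (S :: 'a::field mat4)"
proof -
  obtain v f w g where *: "T = tens v f" "S = tens w g" "pair f v \<noteq> 0" "pair g w \<noteq> 0"
    using assms by (auto simp: HV_def)
  \<comment> \<open>The walk changes the functional to \<open>h\<close>, then the vector, then the
    functional to \<open>g\<close>, so \<open>h\<close> must be nonzero on both vectors. One of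
    \<open>f\<close>, \<open>g\<close>, \<open>f + g\<close> is.\<close>
  obtain h where h: "pair h v \<noteq> 0" "pair h w \<noteq> 0"
  proof (cases "pair f w = 0 \<and> pair g v = 0")
    case True
    then show ?thesis using * that[of "f + g"] by (simp add: pair_add)
  next
    case False
    then show ?thesis using * that by blast
  qed
  have "Hadj\<^sup>*\<^sup>* (tens v f) (tens v h)" "Hadj\<^sup>*\<^sup>* (tens v h) (tens w h)" "Hadj\<^sup>*\<^sup>* (tens w h) (tens w g)"
    using * h by (simp_all add: Hadj_walk_same_vector Hadj_walk_same_functional)
  then show ?thesis using * by simp
qed

text \<open>Without isolated vertices, vertices identified in the reduct share a neighbour and hence
  lie in one component of the lift.\<close>

lemma Hadj_neighbour:
  assumes "T \<in> HV"
  obtains S where "Hadj T (S :: 'a::field mat4)"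
proof -
  obtain v f where *: "T = tens v f" "pair f v \<noteq> 0" using assms by (auto simp: HV_def)
  obtain x where x: "x \<noteq> 0" "pair f x = 0" "pair f x = 0" by (rule common_kernel)
  obtain h where "pair h v = 0" "pair h x \<noteq> 0" by (rule separating_functional[OF *(2) x(2,1)])
  then show ?thesis using that[of "tens x h"] * x by (simp add: Hadj_tens_iff)
qed

section \<open>Walks in the lift and the conserved potential\<close>

context char_two begin

abbreviation conn :: "'a mat4 \<times> 'a S2 set \<Rightarrow> 'a mat4 \<times> 'a S2 set \<Rightarrow> bool" where
  "conn \<equiv> (Ladj c)\<^sup>*\<^sup>*"

text \<open>The antisymmetry required of a voltage assignment, which is symmetry in characteristic
  2.\<close>

lemma ell_commute: "ell c v f w g = ell c w g v f"
proof -
  have "wedge v w = wedge w v" for v w :: "'a V" by (simp add: vec_eq_iff mult.commute add.commute)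
  then show ?thesis
    unfolding ell_def phi_dwedge by (simp add: mult.commute)
qed

lemma Ncl_splus_cong: "Ncl c s = Ncl c t \<Longrightarrow> Ncl c (splus u s) = Ncl c (splus u t)"
  by (simp flip: nadd_Ncl)

lemma LV_cases:
  assumes "x \<in> LV c"
  obtains v f s where "x = (tens v f, Ncl c s)" "pair f v \<noteq> 0" "s \<in> S2set"
  using assms by (auto simp: LV_def HV_def Ncarrier_def)

lemma Ladj_cases:
  assumes "Ladj c x y"
  obtains v f w g s where "pair f v \<noteq> 0" "pair g w \<noteq> 0" "pair f w = 0" "pair g v = 0" "s \<in> S2set"
    "x = (tens v f, Ncl c s)" "y = (tens w g, Ncl c (splus s (ell c v f w g)))"
proof -
  obtain v f w g where a: "x \<in> LV c" "y \<in> LV c" "Hadj (fst x) (fst y)" "fst x = tens v f" "fst y = tens w g"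
    "ellU c v f w g = nsub (snd x) (snd y)"
    using assms unfolding Ladj_def by blast
  obtain s t where st: "s \<in> S2set" "t \<in> S2set" "snd x = Ncl c s" "snd y = Ncl c t"
    using a(1,2) by (auto simp: LV_def Ncarrier_def)
  have "Ncl c (ell c v f w g) = Ncl c (splus s t)"
    using a(6) by (simp add: ellU_def st nsub_Ncl)
  from Ncl_splus_cong[OF this, of s] have "Ncl c t = Ncl c (splus s (ell c v f w g))"
    by simp
  then show ?thesis
    using a st that[of f v g w s] Hadj_tens_iff[of v f w g] by (metis prod.collapse)
qed

lemma Ladj_intro:
  assumes "pair f v \<noteq> 0" "pair g w \<noteq> 0" "pair f w = 0" "pair g v = 0" "s \<in> S2set"
  shows "Ladj c (tens v f, Ncl c s) (tens w g, Ncl c (splus s (ell c v f w g)))"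
proof -
  have "nsub (Ncl c s) (Ncl c (splus s (ell c v f w g))) = ellU c v f w g"
    by (simp add: nsub_Ncl ellU_def)
  then show ?thesis
    using assms unfolding Ladj_def LV_def Ncarrier_def fst_conv snd_conv
    by (intro conjI) (auto simp: Hadj_tens_iff tens_in_HV intro: exI)
qed

lemma Ladj_sym: "Ladj c x y \<Longrightarrow> Ladj c y x"
proof (erule Ladj_cases)
  fix v f w g s
  assume *: "pair f v \<noteq> 0" "pair g w \<noteq> 0" "pair f w = 0" "pair g v = 0" "s \<in> S2set"
    "x = (tens v f, Ncl c s)" "y = (tens w g, Ncl c (splus s (ell c v f w g)))"
  have "splus (splus s (ell c v f w g)) (ell c w g v f) = s"
    by (simp add: ell_commute[of w] splus_assoc)
  with Ladj_intro[of g w f v "splus s (ell c v f w g)"] * show "Ladj c y x" by simp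
qed

lemma conn_sym: "conn x y \<Longrightarrow> conn y x"
  using Ladj_sym by (metis sympI sympD symp_rtranclp)

lemma conn_in_LV: "conn x y \<Longrightarrow> x \<in> LV c \<Longrightarrow> y \<in> LV c"
  by (induction rule: rtranclp_induct) (auto simp: Ladj_def)

lemma Ladj_translate:
  assumes "u \<in> S2set" "Ladj c x y"
  shows "Ladj c (fst x, nadd (snd x) (Ncl c u)) (fst y, nadd (snd y) (Ncl c u))"
  using assms(2)
proof (rule Ladj_cases)
  fix v f w g s
  assume *: "pair f v \<noteq> 0" "pair g w \<noteq> 0" "pair f w = 0" "pair g v = 0" "s \<in> S2set"
    "x = (tens v f, Ncl c s)" "y = (tens w g, Ncl c (splus s (ell c v f w g)))"
  have "splus (splus s (ell c v f w g)) u = splus (splus s u) (ell c v f w g)"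
    by (simp add: splus_ac)
  with Ladj_intro[of f v g w "splus s u"] * assms(1) show ?thesis by (simp add: nadd_Ncl)
qed

lemma conn_translate:
  assumes "u \<in> S2set" "conn (T, Ncl c s) (S, Ncl c t)"
  shows "conn (T, Ncl c (splus s u)) (S, Ncl c (splus t u))"
proof -
  have "conn x y \<Longrightarrow> conn (fst x, nadd (snd x) (Ncl c u)) (fst y, nadd (snd y) (Ncl c u))" for x y
    by (induction rule: rtranclp_induct) (auto dest: Ladj_translate[OF assms(1)] intro: rtranclp.rtrancl_into_rtrancl)
  from this[OF assms(2)] show ?thesis by (simp add: nadd_Ncl)
qed

text \<open>A walk of the connected base graph lifts from any starting point in the fibre.\<close>

lemma conn_lift:
  assumes "T \<in> HV" "S \<in> HV" "s \<in> S2set"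
  obtains t where "t \<in> S2set" "conn (T, Ncl c s) (S, Ncl c t)"
proof -
  have "Hadj\<^sup>*\<^sup>* T S \<Longrightarrow> \<exists>t\<in>S2set. conn (T, Ncl c s) (S, Ncl c t)"
  proof (induction rule: rtranclp_induct)
    case base
    then show ?case using assms(3) by blast
  next
    case (step S S')
    then obtain t where t: "t \<in> S2set" "conn (T, Ncl c s) (S, Ncl c t)" by blast
    obtain v f w g where "S = tens v f" "S' = tens w g" "pair f v \<noteq> 0" "pair g w \<noteq> 0" "pair f w = 0" "pair g v = 0"
      using step(2) unfolding Hadj_def by (metis tens_in_HV_iff)
    with Ladj_intro[of f v g w t] t show ?case by (metis ell_in_S2set rtranclp.rtrancl_into_rtrancl splus_in_S2set)
  qed
  then show ?thesis using Hadj_connected[OF assms(1,2)] that by blast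
qed

text \<open>Fibre coordinate plus potential is constant modulo \<open>SQU\<close> along a walk,
  since \<open>ell_plus_pot\<close> bounds the change on each edge.\<close>

lemma conn_potential:
  assumes "conn (T, Ncl c s) y" "T \<in> HV" "s \<in> S2set"
  obtains S t where "y = (S, Ncl c t)" "S \<in> HV" "t \<in> S2set" "splus (splus s t) (splus (pot T) (pot S)) \<in> SQU"
proof -
  have "\<exists>S t. y = (S, Ncl c t) \<and> S \<in> HV \<and> t \<in> S2set \<and> splus (splus s t) (splus (pot T) (pot S)) \<in> SQU"
    using assms(1)
  proof (induction rule: rtranclp_induct)
    case base
    then show ?case using assms(2,3) by (intro exI[of _ T] exI[of _ s]) simp
  next
    case (step y z)
    then obtain S t where *: "y = (S, Ncl c t)" "splus (splus s t) (splus (pot T) (pot S)) \<in> SQU" by blast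
    from step(2) show ?case
    proof (rule Ladj_cases)
      fix v f w g t'
      assume h: "pair f v \<noteq> 0" "pair g w \<noteq> 0" "pair f w = 0" "pair g v = 0" "t' \<in> S2set"
        "y = (tens v f, Ncl c t')" "z = (tens w g, Ncl c (splus t' (ell c v f w g)))"
      \<comment> \<open>The two representatives of the same class in \<open>N\<close> differ by 0 or
        \<open>U\<close>, which \<open>SQU\<close> absorbs.\<close>
      have S: "S = tens v f" "Ncl c t' = Ncl c t" using * h by auto
      then have 1: "splus t t' \<in> SQU"
        by (auto simp: Ncl_eq_iff splus_ac)
      have "splus (splus s (splus t' (ell c v f w g))) (splus (pot T) (pot (tens w g)))
          = splus (splus t t') (splus (splus (splus s t) (splus (pot T) (pot S)))
            (splus (ell c v f w g) (splus (pot (tens v f)) (pot (tens w g)))))"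
        by (simp add: S splus_ac)
      also have "\<dots> \<in> SQU"
        by (intro splus_in_SQU 1 *(2) ell_plus_pot h)
      finally show ?thesis using h by (auto simp: tens_in_HV)
    qed
  qed
  then show ?thesis using that by blast
qed

section \<open>Closed walks realise all squares\<close>

definition sq :: "4 \<times> 4 \<Rightarrow> 'a \<Rightarrow> 'a S2" where
  "sq I a = (\<lambda>(K, L). if K = I \<and> L = I then a else 0)"

lemma sq_in_SQ: "I \<in> Pidx \<Longrightarrow> sq I a \<in> SQ"
  by (auto simp: SQ_def S2set_def sq_def)

text \<open>The local voltage group at \<open>T\<close>, pulled back from \<open>N\<close> to
  \<open>S_2(W)\<close>.\<close>

definition loops :: "'a mat4 \<Rightarrow> 'a S2 set" where
  "loops T = {u \<in> S2set. conn (T, Ncl c szero) (T, Ncl c u)}"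

lemma loops_conn:
  assumes "u \<in> loops T" "s \<in> S2set"
  shows "conn (T, Ncl c s) (T, Ncl c (splus s u))"
  using conn_translate[OF assms(2), of T szero T u] assms(1) by (simp add: loops_def splus_commute)

lemma splus_in_loops: "u \<in> loops T \<Longrightarrow> u' \<in> loops T \<Longrightarrow> splus u u' \<in> loops T"
  using loops_conn[of u' T u] unfolding loops_def by auto

text \<open>A closed walk at \<open>T\<close> is conjugated by a walk from \<open>S\<close> to
  \<open>T\<close>; as \<open>N\<close> is abelian, the voltage of the connecting walk
  cancels.\<close>

lemma loops_subset:
  assumes "T \<in> HV" "S \<in> HV" "u \<in> loops T"
  shows "u \<in> loops S"
proof -
  have u: "u \<in> S2set" "conn (T, Ncl c szero) (T, Ncl c u)" using assms(3) by (simp_all add: loops_def)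
  obtain t where t: "t \<in> S2set" "conn (S, Ncl c szero) (T, Ncl c t)"
    using conn_lift[OF assms(2,1) szero_in_S2set] .
  have "conn (T, Ncl c t) (T, Ncl c (splus t u))"
    by (rule loops_conn[OF assms(3) t(1)])
  moreover have "conn (T, Ncl c (splus t u)) (S, Ncl c u)"
    using conn_sym[OF conn_translate[OF u(1) t(2)]] by simp
  ultimately show ?thesis using t(2) u(1) unfolding loops_def by auto
qed

lemma four_cycle:
  assumes "pair f1 v1 \<noteq> 0" "pair f2 v2 \<noteq> 0" "pair f3 v3 \<noteq> 0" "pair f4 v4 \<noteq> 0"
    "pair f1 v2 = 0" "pair f2 v1 = 0" "pair f2 v3 = 0" "pair f3 v2 = 0"
    "pair f3 v4 = 0" "pair f4 v3 = 0" "pair f4 v1 = 0" "pair f1 v4 = 0"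
  shows "splus (splus (ell c v1 f1 v2 f2) (ell c v2 f2 v3 f3))
      (splus (ell c v3 f3 v4 f4) (ell c v4 f4 v1 f1)) \<in> loops (tens v1 f1)"
proof -
  define s1 s2 s3 s4 where "s1 = ell c v1 f1 v2 f2" and "s2 = splus s1 (ell c v2 f2 v3 f3)"
    and "s3 = splus s2 (ell c v3 f3 v4 f4)" and "s4 = splus s3 (ell c v4 f4 v1 f1)"
  have S2: "s1 \<in> S2set" "s2 \<in> S2set" "s3 \<in> S2set" "s4 \<in> S2set"
    by (simp_all add: s1_def s2_def s3_def s4_def)
  have "Ladj c (tens v1 f1, Ncl c szero) (tens v2 f2, Ncl c s1)"
    using Ladj_intro[of f1 v1 f2 v2 szero] assms by (simp add: s1_def)
  moreover have "Ladj c (tens v2 f2, Ncl c s1) (tens v3 f3, Ncl c s2)"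
    unfolding s2_def using assms S2 by (intro Ladj_intro)
  moreover have "Ladj c (tens v3 f3, Ncl c s2) (tens v4 f4, Ncl c s3)"
    unfolding s3_def using assms S2 by (intro Ladj_intro)
  moreover have "Ladj c (tens v4 f4, Ncl c s3) (tens v1 f1, Ncl c s4)"
    unfolding s4_def using assms S2 by (intro Ladj_intro)
  ultimately have "conn (tens v1 f1, Ncl c szero) (tens v1 f1, Ncl c s4)"
    by (auto intro: converse_rtranclp_into_rtranclp)
  then have "s4 \<in> loops (tens v1 f1)"
    using S2 by (simp add: loops_def)
  then show ?thesis by (simp add: s1_def s2_def s3_def s4_def splus_assoc)
qed

text \<open>The pair \<open>j, l\<close> is complementary to \<open>(i, k)\<close>, so the star
  sends its bivector to that of \<open>(i, k)\<close>; the factor \<open>c\<close> cancels the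
  \<open>inverse c\<close> in \<open>hodge\<close>.\<close>

lemma hodge_wedge_axis:
  assumes "(i, k) \<in> Pidx" "K \<in> Pidx" "j \<noteq> i" "j \<noteq> k" "l \<noteq> i" "l \<noteq> k" "j \<noteq> l"
  shows "wco (hodge (\<chi> p q. c * a * wedge (axis j 1) (axis l 1) $ p $ q)) K = (if K = (i, k) then a else 0)"
proof -
  have "\<forall>I\<in>Pidx. \<forall>K\<in>Pidx. \<forall>j l. j \<noteq> fst I \<longrightarrow> j \<noteq> snd I \<longrightarrow> l \<noteq> fst I \<longrightarrow> l \<noteq> snd I \<longrightarrow> j \<noteq> l \<longrightarrow>
    wco (hodge (\<chi> p q. c * a * wedge (axis j 1) (axis l 1) $ p $ q)) K = (if K = I then a else 0)"
    unfolding ball_Pidx forall_4 using c_nz by (simp add: hodge_def axis_def)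
  with assms show ?thesis by (metis fst_conv snd_conv)
qed

lemma smul_splus_right: "splus (smul a b) (smul a b') = smul a (b + b')"
  by (auto simp: fun_eq_iff splus_def smul_def wco_def algebra_simps)

lemma hodge_add: "hodge A + hodge B = hodge (A + B)"
  by (simp add: vec_eq_iff forall_4 hodge_def distrib_left)

text \<open>The voltage is biadditive in the two functionals, so in a quadrangle with fixed vectors only
  the product of the two differences \<open>c a e\<^sub>j*\<close> and \<open>e\<^sub>l*\<close> of functionals survives.\<close>
lemma sq_in_loops_axis:
  assumes "(i, k) \<in> Pidx" "{i, j, k, l} = UNIV"
  shows "sq (i, k) a \<in> loops (tens (axis i 1) (axis i 1))"
proof -
  let ?e = "\<lambda>i. axis i 1 :: 'a V"
  let ?v1 = "?e i" and ?v2 = "?e k"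
  let ?f3 = "?e i + (c * a) *s ?e j" and ?f4 = "?e k + ?e l"
  have "card {i, j, k, l} = 4" using assms(2) by simp
  then have d: "i \<noteq> j" "i \<noteq> k" "i \<noteq> l" "j \<noteq> k" "j \<noteq> l" "k \<noteq> l"
    by (auto simp: card_insert_if split: if_splits)
  have ax: "?e p $ q = (if q = p then 1 else 0)" for p q
    by (simp add: axis_def)
  have pairs: "pair f (?e m) = f $ m" for f m
    by (simp add: pair_commute[of f] pair_axis)
  let ?s = "splus (splus (ell c ?v1 ?v1 ?v2 ?v2) (ell c ?v2 ?v2 ?v1 ?f3))
    (splus (ell c ?v1 ?f3 ?v2 ?f4) (ell c ?v2 ?f4 ?v1 ?v1))"
  define Z where "Z = (\<chi> p q. c * a * wedge (?e j) (?e l) $ p $ q)"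
  \<comment> \<open>All four darts are oriented from \<open>?v1\<close> to \<open>?v2\<close>, so
    that their voltages share the first factor \<open>wedge ?v1 ?v2\<close> and the second factors
    can be added.\<close>
  have "?s = splus (splus (ell c ?v1 ?v1 ?v2 ?v2) (ell c ?v1 ?f3 ?v2 ?v2))
    (splus (ell c ?v1 ?f3 ?v2 ?f4) (ell c ?v1 ?v1 ?v2 ?f4))"
    by (simp only: ell_commute[of ?v2])
  also have "\<dots> = smul (wedge ?v1 ?v2) (hodge (wedge ?v1 ?v2 + wedge ?f3 ?v2 + (wedge ?f3 ?f4 + wedge ?v1 ?f4)))"
    using d by (simp add: ell_def sscale_def phi_dwedge pairs smul_splus_right hodge_add ax)
  also have "wedge ?v1 ?v2 + wedge ?f3 ?v2 + (wedge ?f3 ?f4 + wedge ?v1 ?f4) = Z"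
    by (simp add: vec_eq_iff Z_def algebra_simps)
  also have "smul (wedge ?v1 ?v2) (hodge Z) = sq (i, k) a"
  proof (rule S2set_eqI)
    show "sq (i, k) a \<in> S2set" using assms(1) by (simp add: SQ_in_S2set sq_in_SQ)
    have 1: "wco (wedge ?v1 ?v2) K = (if K = (i, k) then 1 else 0)" if "K \<in> Pidx" for K
      using wco_Wbas[OF assms(1) that] by (auto simp: Wbas_def)
    have 2: "wco (hodge Z) K = (if K = (i, k) then a else 0)" if "K \<in> Pidx" for K
      unfolding Z_def by (rule hodge_wedge_axis) (use assms d that in auto)
    show "smul (wedge ?v1 ?v2) (hodge Z) (K, L) = sq (i, k) a (K, L)" if "K \<in> Pidx" "L \<in> Pidx" for K L
      using that by (auto simp: smul_def sq_def 1 2 simp del: wco_pair)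
  qed simp
  finally have "?s = sq (i, k) a" .
  moreover have "?s \<in> loops (tens ?v1 ?v1)"
    using d by (intro four_cycle) (auto simp: pairs ax)
  ultimately show ?thesis by simp
qed

lemma SQ_subset_loops:
  assumes "T \<in> HV" "q \<in> SQ"
  shows "q \<in> loops T"
proof -
  have sq: "sq (i, k) a \<in> loops T" if "(i, k) \<in> Pidx" "{i, j, k, l} = UNIV" for i j k l a
    using sq_in_loops_axis[OF that] loops_subset[OF _ assms(1)] tens_in_HV
    by (metis axis_eq_0_iff axis_nth one_neq_zero pair_axis)
  have "sq I a \<in> loops T" if "I \<in> Pidx" for I a
  proof -
    have U: "{1, 3, 2, 4} = (UNIV :: 4 set)" "{2, 1, 3, 4} = (UNIV :: 4 set)" "{4, 1, 3, 2} = (UNIV :: 4 set)"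
      "{4, 2, 1, 3} = (UNIV :: 4 set)" "{4, 1, 2, 3} = (UNIV :: 4 set)" "{1, 2, 3, 4} = (UNIV :: 4 set)"
      unfolding UNIV_4 by auto
    show ?thesis
      using that sq[of 1 2 3 4 a] sq[of 1 3 2 4 a] sq[of 2 3 1 4 a] sq[of 4 1 2 3 a] sq[of 4 2 1 3 a] sq[of 4 3 1 2 a]
      unfolding Pidx_eq by (elim insertE emptyE) (simp_all only: U insert_iff simp_thms)
  qed
  \<comment> \<open>An element of \<open>SQ\<close> is the sum of its six diagonal parts.\<close>
  then have "splus (splus (splus (sq (1,2) (q ((1,2),(1,2)))) (sq (1,3) (q ((1,3),(1,3)))))
       (splus (sq (2,3) (q ((2,3),(2,3)))) (sq (4,1) (q ((4,1),(4,1))))))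
     (splus (sq (4,2) (q ((4,2),(4,2)))) (sq (4,3) (q ((4,3),(4,3))))) \<in> loops T" (is "?s \<in> _")
    by (intro splus_in_loops) (auto simp: Pidx_eq)
  also have "?s = q"
  proof (rule S2set_eqI)
    show "?s \<in> S2set" by (simp add: Pidx_eq SQ_in_S2set sq_in_SQ)
    show "q \<in> S2set" using assms(2) by (rule SQ_in_S2set)
    have "q (I, J) = 0" if "I \<noteq> J" for I J using assms(2) that unfolding SQ_def by blast
    then have "\<forall>I\<in>Pidx. \<forall>J\<in>Pidx. ?s (I, J) = q (I, J)"
      unfolding ball_Pidx by (simp add: splus_def sq_def)
    then show "?s (I, J) = q (I, J)" if "I \<in> Pidx" "J \<in> Pidx" for I J using that by blast
  qed
  finally show ?thesis .
qed

text \<open>The potential is a complete invariant: conservation gives one direction, and closed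
  walks make up any discrepancy in \<open>SQ\<close> for the other.\<close>

lemma conn_iff:
  assumes "T \<in> HV" "S \<in> HV" "s \<in> S2set" "t \<in> S2set"
  shows "conn (T, Ncl c s) (S, Ncl c t) \<longleftrightarrow> splus (splus s t) (splus (pot T) (pot S)) \<in> SQU"
proof
  assume "conn (T, Ncl c s) (S, Ncl c t)"
  then show "splus (splus s t) (splus (pot T) (pot S)) \<in> SQU"
  proof (rule conn_potential[OF _ assms(1,3)])
    fix S' t'
    assume *: "(S, Ncl c t) = (S', Ncl c t')" "splus (splus s t') (splus (pot T) (pot S')) \<in> SQU"
    then have "splus t t' \<in> SQU" by (auto simp: Ncl_eq_iff splus_ac)
    moreover have "splus (splus s t) (splus (pot T) (pot S))
      = splus (splus t t') (splus (splus s t') (splus (pot T) (pot S')))"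
      using * by (simp add: splus_ac)
    ultimately show ?thesis using * by (simp add: splus_in_SQU)
  qed
next
  assume 1: "splus (splus s t) (splus (pot T) (pot S)) \<in> SQU"
  \<comment> \<open>Some vertex over \<open>S\<close> is reachable. Its fibre coordinate differs
    from \<open>t\<close> by an element of \<open>SQU\<close>, whose square part is realised by a
    closed walk while \<open>U\<close> is invisible in \<open>N\<close>.\<close>
  obtain y where y: "y \<in> S2set" "conn (T, Ncl c s) (S, Ncl c y)" using conn_lift[OF assms(1,2,3)] .
  from y(2) have "splus y t \<in> SQU"
  proof (rule conn_potential[OF _ assms(1,3)])
    fix S' t'
    assume *: "(S, Ncl c y) = (S', Ncl c t')" "splus (splus s t') (splus (pot T) (pot S')) \<in> SQU"
    then have "splus y t' \<in> SQU" by (auto simp: Ncl_eq_iff splus_ac)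
    moreover have "splus y t = splus (splus y t')
      (splus (splus (splus s t) (splus (pot T) (pot S))) (splus (splus s t') (splus (pot T) (pot S'))))"
      using * by (simp add: splus_ac)
    ultimately show ?thesis using 1 * by (simp add: splus_in_SQU)
  qed
  then obtain q where q: "q \<in> SQ" "splus y t = q \<or> splus y t = splus q (Uel c)"
    by (auto simp: SQU_def)
  then have "t = splus y q \<or> t = splus (splus y q) (Uel c)"
    by (metis splus_assoc splus_left_self)
  then have "Ncl c t = Ncl c (splus y q)" by (auto simp: Ncl_eq_iff splus_ac)
  moreover have "conn (S, Ncl c y) (S, Ncl c (splus y q))"
    by (intro loops_conn SQ_subset_loops assms q y)
  ultimately show "conn (T, Ncl c s) (S, Ncl c t)" using y(2) by simp
qed

end

section \<open>The action on the reduct and the stabilizer of a component\<close>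

lemma SL4_inverse_mult:
  assumes "g \<in> SL4" "h \<in> SL4"
  shows "matrix_inv (g ** h) = matrix_inv h ** matrix_inv (g :: 'a::field mat4)"
proof -
  have "matrix_inv (g ** h) = matrix_inv (g ** h) ** (g ** (h ** matrix_inv h) ** matrix_inv g)"
    using assms by (simp add: SL4_inverse)
  also have "\<dots> = (matrix_inv (g ** h) ** (g ** h)) ** (matrix_inv h ** matrix_inv g)"
    by (simp add: matrix_mul_assoc)
  finally show ?thesis using SL4_inverse[OF SL4_mult[OF assms]] by simp
qed

lemma tens_act: "tens (vact g v) (dact g f) = transpose g ** tens v f ** transpose (matrix_inv g)"
  by (simp add: vec_eq_iff vact_def dact_def matrix_matrix_mult_def vector_matrix_mult_def matrix_vector_mult_def
      transpose_def sum_product sum_distrib_right sum_distrib_left mult_ac)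

text \<open>The choice of factors in \<open>tact\<close> is harmless, since the result is a matrix
  expression in \<open>T\<close> alone.\<close>

lemma tact_eq:
  assumes "T \<in> HV"
  shows "tact g T = transpose g ** T ** transpose (matrix_inv g)"
proof -
  obtain v f where "T = tens v f" using assms by (auto simp: HV_def)
  then have "\<exists>T' v f. T = tens v f \<and> T' = tens (vact g v) (dact g f)" by blast
  from someI_ex[OF this] show ?thesis
    unfolding tact_def by (auto simp: tens_act)
qed

lemma tact_tens:
  "pair f v \<noteq> 0 \<Longrightarrow> tact g (tens v f) = tens (vact g v) (dact g f)"
  by (simp add: tact_eq tens_in_HV tens_act)

lemma tact_in_HV: "g \<in> SL4 \<Longrightarrow> T \<in> HV \<Longrightarrow> tact g T \<in> HV"
  by (auto simp: HV_def tact_tens pair_act) (metis pair_act)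

lemma tact_mult:
  assumes "g \<in> SL4" "h \<in> SL4" "T \<in> HV"
  shows "tact (g ** h) T = tact h (tact g T)"
proof -
  have "tact h (tact g T) = transpose h ** tact g T ** transpose (matrix_inv h)"
    by (rule tact_eq[OF tact_in_HV[OF assms(1,3)]])
  then show ?thesis
    by (simp add: assms tact_eq[OF assms(3)] SL4_inverse_mult matrix_transpose_mul matrix_mul_assoc)
qed

lemma tact_one: "T \<in> HV \<Longrightarrow> tact (mat 1) T = T"
proof -
  have "matrix_inv (mat 1 :: 'a mat4) = mat 1"
    using SL4_inverse(1)[OF SL4_one] by simp
  then show "T \<in> HV \<Longrightarrow> tact (mat 1) T = T" by (simp add: tact_eq transpose_mat)
qed

context char_two begin

section \<open>The semidirect product and its action on the lift\<close>

lemma SDP_carrier: "carrier (SDP c) = SL4 \<times> Ncarrier c"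
  and SDP_mult: "(g, k) \<otimes>\<^bsub>SDP c\<^esub> (h, l) = (g ** h, nadd (nact h k) l)"
  and SDP_one: "\<one>\<^bsub>SDP c\<^esub> = (mat 1, Ncl c szero)"
  by (simp_all add: SDP_def)

lemma SDP_cases:
  assumes "h \<in> carrier (SDP c)"
  obtains g s where "h = (g, Ncl c s)" "g \<in> SL4" "s \<in> S2set"
  using assms by (auto simp: SDP_carrier Ncarrier_def)

lemma in_SDP_iff [simp]: "(g, Ncl c s) \<in> carrier (SDP c) \<longleftrightarrow> g \<in> SL4" if "s \<in> S2set"
  using that by (auto simp: SDP_carrier Ncarrier_def)

lemma SDP_mult_Ncl: "h \<in> SL4 \<Longrightarrow> (g, Ncl c s) \<otimes>\<^bsub>SDP c\<^esub> (h, Ncl c t) = (g ** h, Ncl c (splus (sact h s) t))"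
  by (simp add: SDP_mult nact_Ncl nadd_Ncl)

lemma SDP_group: "group (SDP c)"
proof (rule groupI)
  fix x y z
  assume "x \<in> carrier (SDP c)" "y \<in> carrier (SDP c)" "z \<in> carrier (SDP c)"
  then show "x \<otimes>\<^bsub>SDP c\<^esub> y \<otimes>\<^bsub>SDP c\<^esub> z = x \<otimes>\<^bsub>SDP c\<^esub> (y \<otimes>\<^bsub>SDP c\<^esub> z)"
    by (elim SDP_cases) (simp add: SDP_mult_Ncl SL4_mult matrix_mul_assoc sact_mult sact_splus splus_assoc)
next
  fix x y
  assume "x \<in> carrier (SDP c)" "y \<in> carrier (SDP c)"
  then show "x \<otimes>\<^bsub>SDP c\<^esub> y \<in> carrier (SDP c)"
    by (elim SDP_cases) (simp add: SDP_mult_Ncl SL4_mult)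
next
  show "\<one>\<^bsub>SDP c\<^esub> \<in> carrier (SDP c)" by (simp add: SDP_one)
next
  fix x
  assume "x \<in> carrier (SDP c)"
  then show "\<one>\<^bsub>SDP c\<^esub> \<otimes>\<^bsub>SDP c\<^esub> x = x"
    by (elim SDP_cases) (simp add: SDP_mult_Ncl SDP_one)
next
  fix x
  assume "x \<in> carrier (SDP c)"
  then obtain g s where x: "x = (g, Ncl c s)" "g \<in> SL4" "s \<in> S2set" by (rule SDP_cases)
  let ?y = "(matrix_inv g, Ncl c (sact (matrix_inv g) s))"
  have "sact g (sact (matrix_inv g) s) = s"
    using x by (simp add: SL4_inverse flip: sact_mult)
  then have "?y \<otimes>\<^bsub>SDP c\<^esub> x = \<one>\<^bsub>SDP c\<^esub>"
    using x by (simp add: SDP_mult_Ncl SDP_one SL4_inverse)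
  moreover have "?y \<in> carrier (SDP c)" using x by (simp add: SL4_inverse)
  ultimately show "\<exists>y\<in>carrier (SDP c). y \<otimes>\<^bsub>SDP c\<^esub> x = \<one>\<^bsub>SDP c\<^esub>" by blast
qed

interpretation SDP: group "SDP c" by (rule SDP_group)

text \<open>The action before passing to the reduct; \<open>ract\<close> is what it induces on
  classes.\<close>

definition lact :: "'a mat4 \<times> 'a S2 set \<Rightarrow> 'a mat4 \<times> 'a S2 set \<Rightarrow> 'a mat4 \<times> 'a S2 set" where
  "lact h x = (tact (fst h) (fst x), nadd (nact (fst h) (snd x)) (snd h))"

lemma lact_Ncl: "g \<in> SL4 \<Longrightarrow> lact (g, Ncl c k) (T, Ncl c s) = (tact g T, Ncl c (splus (sact g s) k))"
  by (simp add: lact_def nact_Ncl nadd_Ncl)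

lemma in_LV_iff [simp]: "(T, Ncl c s) \<in> LV c \<longleftrightarrow> T \<in> HV" if "s \<in> S2set"
  using that by (auto simp: LV_def Ncarrier_def)

lemma lact_in_LV: "h \<in> carrier (SDP c) \<Longrightarrow> x \<in> LV c \<Longrightarrow> lact h x \<in> LV c"
  by (elim SDP_cases LV_cases) (simp add: lact_Ncl tact_in_HV tens_in_HV)

lemma lact_mult:
  "h \<in> carrier (SDP c) \<Longrightarrow> k \<in> carrier (SDP c) \<Longrightarrow> x \<in> LV c \<Longrightarrow> lact (h \<otimes>\<^bsub>SDP c\<^esub> k) x = lact k (lact h x)"
  by (elim SDP_cases LV_cases)
     (simp add: SDP_mult_Ncl lact_Ncl SL4_mult tact_mult tens_in_HV sact_mult sact_splus splus_assoc)

lemma lact_one: "x \<in> LV c \<Longrightarrow> lact \<one>\<^bsub>SDP c\<^esub> x = x"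
  by (elim LV_cases) (simp add: SDP_one lact_Ncl tact_one tens_in_HV)

lemma lact_inv:
  assumes "h \<in> carrier (SDP c)" "x \<in> LV c"
  shows "lact (inv\<^bsub>SDP c\<^esub> h) (lact h x) = x" "lact h (lact (inv\<^bsub>SDP c\<^esub> h) x) = x"
  using assms by (simp_all add: lact_one flip: lact_mult)

text \<open>Equivariance of the voltages, \<open>ell_act\<close>, handles the matrix part; the
  translation part is common to both ends.\<close>

lemma Ladj_lact:
  assumes h: "h \<in> carrier (SDP c)" and xy: "Ladj c x y"
  shows "Ladj c (lact h x) (lact h y)"
proof -
  obtain g k where g: "h = (g, Ncl c k)" "g \<in> SL4" "k \<in> S2set" using h by (rule SDP_cases)
  from xy show ?thesis
  proof (rule Ladj_cases)
    fix v f w f' s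
    assume *: "pair f v \<noteq> 0" "pair f' w \<noteq> 0" "pair f w = 0" "pair f' v = 0" "s \<in> S2set"
      "x = (tens v f, Ncl c s)" "y = (tens w f', Ncl c (splus s (ell c v f w f')))"
    have "Ladj c (tens (vact g v) (dact g f), Ncl c (splus (sact g s) k))
      (tens (vact g w) (dact g f'), Ncl c (splus (splus (sact g s) k) (ell c (vact g v) (dact g f) (vact g w) (dact g f'))))"
      by (rule Ladj_intro) (use * g in \<open>simp_all add: pair_act\<close>)
    then show ?thesis
      using * g by (simp add: lact_Ncl tact_tens ell_act sact_splus splus_ac)
  qed
qed

lemma conn_lact: "h \<in> carrier (SDP c) \<Longrightarrow> conn x y \<Longrightarrow> conn (lact h x) (lact h y)"
  by (rotate_tac, induction rule: rtranclp_induct) (auto dest: Ladj_lact intro: rtranclp.rtrancl_into_rtrancl)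

lemma Ladj_in_LV: "Ladj c x y \<Longrightarrow> x \<in> LV c" "Ladj c x y \<Longrightarrow> y \<in> LV c"
  by (simp_all add: Ladj_def)

section \<open>Passage to the reduct\<close>

lemma rclass_iff: "y \<in> rclass c x \<longleftrightarrow> y \<in> LV c \<and> (\<forall>z. Ladj c y z \<longleftrightarrow> Ladj c x z)"
proof -
  have "Lnbhd c x = {z. Ladj c x z}" for x
    unfolding Lnbhd_def using Ladj_in_LV(2) by blast
  then show ?thesis unfolding rclass_def by blast
qed

lemma rclass_eq_iff:
  assumes "x \<in> LV c" "y \<in> LV c"
  shows "rclass c y = rclass c x \<longleftrightarrow> (\<forall>z. Ladj c y z \<longleftrightarrow> Ladj c x z)"
proof
  assume "rclass c y = rclass c x"
  moreover have "y \<in> rclass c y" using assms(2) by (simp add: rclass_iff)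
  ultimately show "\<forall>z. Ladj c y z \<longleftrightarrow> Ladj c x z" by (metis rclass_iff)
next
  assume "\<forall>z. Ladj c y z \<longleftrightarrow> Ladj c x z"
  then have "w \<in> rclass c y \<longleftrightarrow> w \<in> rclass c x" for w unfolding rclass_iff by blast
  then show "rclass c y = rclass c x" by blast
qed

text \<open>Automorphisms preserve equality of neighbourhoods, so the representative chosen in
  \<open>ract\<close> does not matter.\<close>

lemma rclass_lact:
  assumes h: "h \<in> carrier (SDP c)" and x: "x \<in> LV c" and y: "y \<in> rclass c x"
  shows "rclass c (lact h y) = rclass c (lact h x)"
proof -
  have hi: "inv\<^bsub>SDP c\<^esub> h \<in> carrier (SDP c)" using h by simp
  have *: "Ladj c (lact h u') z"
    if "u \<in> LV c" "u' \<in> LV c" "\<forall>z. Ladj c u z \<longleftrightarrow> Ladj c u' z" "Ladj c (lact h u) z" for u u' z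
  proof -
    have "z \<in> LV c" using that(4) by (simp add: Ladj_def)
    then show ?thesis
      using Ladj_lact[OF hi that(4)] Ladj_lact[OF h, of u' "lact (inv\<^bsub>SDP c\<^esub> h) z"] that h by (simp add: lact_inv)
  qed
  have "y \<in> LV c" "\<forall>z. Ladj c y z \<longleftrightarrow> Ladj c x z" using y by (simp_all add: rclass_iff)
  then show ?thesis using x h *[of x y] *[of y x] by (auto simp: rclass_eq_iff lact_in_LV)
qed

lemma ract_rclass:
  assumes h: "h \<in> carrier (SDP c)" and x: "x \<in> LV c"
  shows "ract c h (rclass c x) = rclass c (lact h x)"
proof -
  have "x \<in> rclass c x" using x by (simp add: rclass_iff)
  then have "(SOME y. y \<in> rclass c x) \<in> rclass c x" by (rule someI)
  from rclass_lact[OF h x this] show ?thesis by (simp add: ract_def lact_def)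
qed

text \<open>Members of a class have the same neighbours, so each end of an edge may be exchanged
  within its class.\<close>

lemma Radj_rclass_iff:
  assumes "x \<in> LV c" "y \<in> LV c"
  shows "(rclass c x, rclass c y) \<in> Radj c \<longleftrightarrow> Ladj c x y"
proof
  assume "(rclass c x, rclass c y) \<in> Radj c"
  then obtain x' y' where *: "x' \<in> rclass c x" "y' \<in> rclass c y" "Ladj c x' y'" unfolding Radj_def by blast
  then have "Ladj c y' x" by (metis rclass_iff Ladj_sym)
  then show "Ladj c x y" using *(2) by (metis rclass_iff Ladj_sym)
next
  assume "Ladj c x y"
  moreover have "x \<in> rclass c x" "y \<in> rclass c y" using assms by (simp_all add: rclass_iff)
  ultimately show "(rclass c x, rclass c y) \<in> Radj c"
    using assms unfolding Radj_def RV_def by blast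
qed

lemma Radj_image:
  assumes "x \<in> LV c"
  shows "(Radj c)\<^sup>* `` {rclass c x} = rclass c ` {y. conn x y}"
proof -
  have "\<exists>y. conn x y \<and> Y = rclass c y" if "(rclass c x, Y) \<in> (Radj c)\<^sup>*" for Y
    using that
  proof (induction rule: rtrancl_induct)
    case (step Y Z)
    then obtain y where y: "conn x y" "Y = rclass c y" by blast
    obtain z where z: "Z = rclass c z" "z \<in> LV c" using step(2) unfolding Radj_def RV_def by blast
    have "Ladj c y z" using step(2) y z Radj_rclass_iff[of y z] conn_in_LV[OF y(1) assms] by simp
    then show ?case using y z by (metis rtranclp.rtrancl_into_rtrancl)
  qed blast
  moreover have "(rclass c x, rclass c y) \<in> (Radj c)\<^sup>*" if "conn x y" for y
    using that
  proof (induction rule: rtranclp_induct)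
    case (step y z)
    then have "y \<in> LV c" "z \<in> LV c" unfolding Ladj_def by blast+
    then have "(rclass c y, rclass c z) \<in> Radj c" using step(2) by (simp add: Radj_rclass_iff)
    with step.IH show ?case by (rule rtrancl.rtrancl_into_rtrancl)
  qed auto
  ultimately show ?thesis by blast
qed

text \<open>The component contains some \<open>z\<close> in the class of \<open>y\<close>. Any
  neighbour of \<open>z\<close> is a neighbour of \<open>y\<close> and joins the two; one exists by
  \<open>Hadj_neighbour\<close>.\<close>

lemma rclass_in_component:
  assumes x: "x \<in> LV c" and y: "y \<in> LV c" and r: "rclass c y \<in> rclass c ` {z. conn x z}"
  shows "conn x y"
proof -
  obtain z where z: "conn x z" "rclass c y = rclass c z" using r by blast
  have zL: "z \<in> LV c" by (rule conn_in_LV[OF z(1) x])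
  obtain T s where T: "z = (T, Ncl c s)" "T \<in> HV" "s \<in> S2set" using zL by (auto elim: LV_cases simp: tens_in_HV)
  obtain S where S: "Hadj T S" using Hadj_neighbour[OF T(2)] .
  obtain v f w g where "T = tens v f" "S = tens w g" "pair f v \<noteq> 0" "pair g w \<noteq> 0" "pair f w = 0" "pair g v = 0"
    using S unfolding Hadj_def by (metis tens_in_HV_iff)
  with Ladj_intro[of f v g w s] T have "Ladj c z (S, Ncl c (splus s (ell c v f w g)))" by simp
  moreover from this have "Ladj c y (S, Ncl c (splus s (ell c v f w g)))"
    using z(2) x y zL by (simp add: rclass_eq_iff)
  ultimately show ?thesis using z(1) by (meson Ladj_sym rtranclp.rtrancl_into_rtrancl)
qed

text \<open>Automorphisms permute the components, so a component is fixed as soon as one of its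
  vertices stays inside it.\<close>

lemma stabC_iff:
  assumes x: "x \<in> LV c"
  shows "h \<in> stabC c (rclass c ` {y. conn x y}) \<longleftrightarrow> h \<in> carrier (SDP c) \<and> conn x (lact h x)"
proof (cases "h \<in> carrier (SDP c)")
  case h: True
  have L: "y \<in> LV c" if "conn x y" for y using conn_in_LV[OF that x] .
  have hx: "lact h x \<in> LV c" by (rule lact_in_LV[OF h x])
  have "ract c h ` rclass c ` {y. conn x y} = rclass c ` {y. conn (lact h x) y}"
  proof -
    have "ract c h ` rclass c ` {y. conn x y} = rclass c ` lact h ` {y. conn x y}"
      unfolding image_image by (intro image_cong refl) (simp add: ract_rclass h L)
    moreover have "lact h ` {y. conn x y} = {y. conn (lact h x) y}"
    proof (intro equalityI subsetI)
      fix y assume "y \<in> {y. conn (lact h x) y}"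
      then have y: "conn (lact h x) y" by simp
      have "y \<in> LV c" by (rule conn_in_LV[OF y hx])
      moreover have "conn x (lact (inv\<^bsub>SDP c\<^esub> h) y)"
        using conn_lact[OF SDP.inv_closed[OF h] y] h x by (simp add: lact_inv)
      ultimately show "y \<in> lact h ` {y. conn x y}"
        using h by (intro image_eqI[of _ _ "lact (inv\<^bsub>SDP c\<^esub> h) y"]) (simp_all add: lact_inv)
    qed (auto simp: conn_lact h)
    ultimately show ?thesis by simp
  qed
  moreover have "rclass c ` {y. conn (lact h x) y} = rclass c ` {y. conn x y} \<longleftrightarrow> conn x (lact h x)"
  proof
    assume "rclass c ` {y. conn (lact h x) y} = rclass c ` {y. conn x y}"
    then have "rclass c (lact h x) \<in> rclass c ` {y. conn x y}" by blast
    then show "conn x (lact h x)" by (rule rclass_in_component[OF x hx])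
  next
    assume "conn x (lact h x)"
    then have "{y. conn (lact h x) y} = {y. conn x y}" by (auto intro: rtranclp_trans dest: conn_sym)
    then show "rclass c ` {y. conn (lact h x) y} = rclass c ` {y. conn x y}" by simp
  qed
  ultimately show ?thesis using h by (simp add: stabC_def)
qed (simp add: stabC_def)

lemma stabC_subgroup:
  assumes x: "x \<in> LV c"
  shows "subgroup (stabC c (rclass c ` {y. conn x y})) (SDP c)"
proof (rule SDP.subgroupI)
  show "stabC c (rclass c ` {y. conn x y}) \<subseteq> carrier (SDP c)" by (auto simp: stabC_def)
  have "\<one>\<^bsub>SDP c\<^esub> \<in> stabC c (rclass c ` {y. conn x y})" using x by (simp add: stabC_iff lact_one)
  then show "stabC c (rclass c ` {y. conn x y}) \<noteq> {}" by blast
next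
  fix h assume "h \<in> stabC c (rclass c ` {y. conn x y})"
  then have h: "h \<in> carrier (SDP c)" "conn x (lact h x)" by (simp_all add: stabC_iff x)
  have "conn (lact (inv\<^bsub>SDP c\<^esub> h) x) x" using conn_lact[OF SDP.inv_closed[OF h(1)] h(2)] h x by (simp add: lact_inv)
  then show "inv\<^bsub>SDP c\<^esub> h \<in> stabC c (rclass c ` {y. conn x y})" using h x by (simp add: stabC_iff conn_sym)
next
  fix h k assume "h \<in> stabC c (rclass c ` {y. conn x y})" "k \<in> stabC c (rclass c ` {y. conn x y})"
  then have hk: "h \<in> carrier (SDP c)" "conn x (lact h x)" "k \<in> carrier (SDP c)" "conn x (lact k x)"
    by (simp_all add: stabC_iff x)
  have "conn x (lact k (lact h x))" using conn_lact[OF hk(3,2)] hk(4) by (rule rtranclp_trans[rotated])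
  then show "h \<otimes>\<^bsub>SDP c\<^esub> k \<in> stabC c (rclass c ` {y. conn x y})" using hk x by (simp add: stabC_iff lact_mult)
qed

text \<open>The component meets the fibre over \<open>E\<close>, say in the class of
  \<open>m\<close>. An element fixes the component iff it moves this vertex within it, which
  \<open>conn_iff\<close> turns into an equation modulo \<open>SQU\<close>.\<close>

lemma component_stabilizer:
  assumes C: "C \<in> Rcomponents c" and E: "E \<in> HV"
  obtains m :: "'a S2" where "m \<in> S2set" "subgroup (stabC c C) (SDP c)"
    "\<And>g (k :: 'a S2). g \<in> SL4 \<Longrightarrow> k \<in> S2set \<Longrightarrow> (g, Ncl c k) \<in> stabC c C \<longleftrightarrow>
       splus (splus (splus (sact g m) m) k) (splus (pot (tact g E)) (pot E)) \<in> SQU"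
proof -
  obtain x where x: "x \<in> LV c" "C = (Radj c)\<^sup>* `` {rclass c x}"
    using C unfolding Rcomponents_def RV_def by blast
  obtain T s where T: "x = (T, Ncl c s)" "T \<in> HV" "s \<in> S2set" using x(1) by (auto elim: LV_cases simp: tens_in_HV)
  obtain m where m: "m \<in> S2set" "conn x (E, Ncl c m)" using conn_lift[OF T(2) E T(3)] T(1) by metis
  have "{y. conn x y} = {y. conn (E, Ncl c m) y}"
    using m(2) by (auto intro: rtranclp_trans dest: conn_sym)
  then have C': "C = rclass c ` {y. conn (E, Ncl c m) y}" using Radj_image[OF x(1)] x(2) by simp
  have EL: "(E, Ncl c m) \<in> LV c" using E m by simp
  show ?thesis
  proof (rule that[OF m(1)])
    show "subgroup (stabC c C) (SDP c)" unfolding C' by (rule stabC_subgroup[OF EL])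
    fix g :: "'a mat4" and k :: "'a S2"
    assume gk: "g \<in> SL4" "k \<in> S2set"
    then show "(g, Ncl c k) \<in> stabC c C \<longleftrightarrow>
       splus (splus (splus (sact g m) m) k) (splus (pot (tact g E)) (pot E)) \<in> SQU"
      unfolding C' stabC_iff[OF EL] using E m
      by (simp add: lact_Ncl conn_iff tact_in_HV splus_ac)
  qed
qed

end

section \<open>The extension and its non-splitness\<close>

text \<open>A complement of the kernel maps bijectively onto the image.\<close>

lemma (in group_hom) complement_props:
  assumes C: "subgroup C G" and int: "C \<inter> kernel G H h = {\<one>}" and gen: "kernel G H h <#> C = carrier G"
  shows complement_inj: "inj_on h C" and complement_surj: "h ` C = h ` carrier G"
proof -
  have CG: "x \<in> carrier G" if "x \<in> C" for x using subgroup.mem_carrier[OF C that] .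
  show "inj_on h C"
  proof (rule inj_onI)
    fix x y assume xy: "x \<in> C" "y \<in> C" "h x = h y"
    then have "x \<otimes> inv y \<in> C \<inter> kernel G H h"
      by (simp add: kernel_def CG subgroup.m_closed[OF C] subgroup.m_inv_closed[OF C])
    then have "x \<otimes> inv y = \<one>" using int by blast
    then show "x = y" using xy CG by (metis G.inv_closed G.inv_equality G.inv_inv)
  qed
  show "h ` C = h ` carrier G"
  proof
    show "h ` carrier G \<subseteq> h ` C"
    proof (intro subsetI)
      fix z assume "z \<in> h ` carrier G"
      then obtain x where x: "x \<in> carrier G" "z = h x" by blast
      then obtain k y where "k \<in> kernel G H h" "y \<in> C" "x = k \<otimes> y"
        using gen unfolding set_mult_def by blast
      then show "z \<in> h ` C" using x CG by (auto simp: kernel_def)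
    qed
  qed (use CG in blast)
qed

definition transvection :: "4 \<Rightarrow> 4 \<Rightarrow> 'a::field \<Rightarrow> 'a mat4" where
  "transvection i j a = (\<chi> p q. (if p = q then 1 else 0) + (if p = i \<and> q = j then a else 0))"

context char_two begin

section \<open>Two commuting families of transvections\<close>

lemma eq_if_add_eq_0: "x + y = 0 \<Longrightarrow> x = (y :: 'a)"
  by (metis add_eq_0_iff minus_eq)

lemma add_eq_0_if_eq: "x = y \<Longrightarrow> x + y = (0 :: 'a)"
  by simp

lemma transvections_SL4: "transvection 3 1 a \<in> SL4" "transvection 4 2 a \<in> SL4"
  by (simp_all add: SL4_def det_4 transvection_def)

lemma transvections_commute: "transvection 3 1 a ** transvection 4 2 b = transvection 4 2 b ** transvection 3 1 (a :: 'a)"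
  by (simp add: vec_eq_iff forall_4 transvection_def matrix_matrix_mult_def sum_4)

lemma transvections_inv:
  "matrix_inv (transvection 3 1 a) = transvection 3 1 (a :: 'a)"
  "matrix_inv (transvection 4 2 a) = transvection 4 2 (a :: 'a)"
proof -
  have inv: "matrix_inv g = g" if "g \<in> SL4" "g ** g = mat 1" for g :: "'a mat4"
    using SL4_inverse(1)[OF that(1)] that(2) by (metis matrix_mul_assoc matrix_mul_lid matrix_mul_rid)
  show "matrix_inv (transvection 3 1 a) = transvection 3 1 (a :: 'a)"
    by (rule inv[OF transvections_SL4(1)])
       (simp add: vec_eq_iff forall_4 transvection_def matrix_matrix_mult_def sum_4 mat_def)
  show "matrix_inv (transvection 4 2 a) = transvection 4 2 (a :: 'a)"
    by (rule inv[OF transvections_SL4(2)])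
       (simp add: vec_eq_iff forall_4 transvection_def matrix_matrix_mult_def sum_4 mat_def)
qed

text \<open>This base vertex is fixed by the second family and only its vector moves under the
  first, so a single potential difference enters the computation.\<close>

abbreviation E33 :: "'a mat4" where "E33 \<equiv> tens (axis 3 1) (axis 3 1)"

lemma E33_in_HV: "E33 \<in> HV"
  by (simp add: tens_in_HV pair_axis)

lemma tact_E33:
  "tact (transvection 3 1 a) E33 = tens (axis 3 1 + a *s axis 1 1) (axis 3 1)"
  "tact (transvection 4 2 a) E33 = E33"
  unfolding tact_eq[OF E33_in_HV] transvections_inv
  by (simp_all add: vec_eq_iff forall_4 transpose_def transvection_def
      matrix_matrix_mult_def sum_4 axis_def)

text \<open>The pairs share the index 1 and both miss 3, so the coefficient is the entry
  \<open>(1, 3)\<close> of the tensor, which has trace 1.\<close>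

lemma pot_E33: "pot E33 ((4,1),(1,2)) = 0"
  "pot (tens (axis 3 1 + a *s axis 1 1) (axis 3 1)) ((4,1),(1,2)) = inverse c * a"
  unfolding pot_def sscale_def trace_tens pair_axis
  by (simp_all add: lin_pot_def Pidx_eq opp_def sum_4 axis_def)

text \<open>The first two items give the coefficient of the square of the bivector
  \<open>(1,2)\<close> in the commutator; the last two evaluate the mixed coefficients that occur
  there.\<close>

lemma sact_transvection:
  fixes s :: "'a S2"
  shows "sact (transvection 4 2 b) s ((1,2),(1,2)) = s ((1,2),(1,2)) + b * s ((4,1),(1,2)) + b * b * s ((4,1),(4,1))"
  "sact (transvection 3 1 b) s ((1,2),(1,2)) = s ((1,2),(1,2)) + b * s ((1,2),(2,3)) + b * b * s ((2,3),(2,3))"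
  "sact (transvection 3 1 b) s ((4,1),(1,2)) =
     s ((4,1),(1,2)) + b * s ((4,1),(2,3)) + b * s ((4,3),(1,2)) + b * b * s ((4,3),(2,3))"
  "sact (transvection 4 2 b) s ((1,2),(2,3)) =
     s ((1,2),(2,3)) + b * s ((4,3),(1,2)) + b * s ((4,1),(2,3)) + b * b * s ((4,1),(4,3))"
  by (simp_all add: sact_eq sum_Pidx plex_def less_4 not_less_4 smul_def Pidx_eq wact_Wbas transvection_def algebra_simps)

lemma Ncl_splus_Uel: "Ncl c (splus s (Uel c)) = Ncl c s"
  by (simp add: Ncl_eq splus_assoc insert_commute)

lemma SQ_zero: "s \<in> SQ \<Longrightarrow> I \<noteq> J \<Longrightarrow> s (I, J) = 0"
  unfolding SQ_def by blast

text \<open>At these positions congruences modulo \<open>SQU\<close> become equations in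
  \<open>F\<close>.\<close>

lemma SQU_zero: "s \<in> SQU \<Longrightarrow> I \<noteq> J \<Longrightarrow> \<not> opp I J \<Longrightarrow> s (I, J) = 0"
  by (auto simp: SQU_def SQ_zero splus_def Uel_apply)

text \<open>After division by \<open>a * a * b * b\<close> the right side is a function of
  \<open>b\<close> plus a function of \<open>a\<close>, so its sum over \<open>a\<close> and
  \<open>b\<close> in the set of \<open>1\<close> and \<open>d\<close> vanishes in characteristic 2.
  The left side gives \<open>(1 + 1/d)^2 / c\<close>, which forces \<open>d = 1\<close>.\<close>

lemma inverse_not_separable:
  assumes "(d :: 'a) \<noteq> 0" "d \<noteq> 1" and eq: "\<And>a b. a * b * inverse c = a * a * Y b + b * b * X a"
  shows False
proof -
  have 1: "inverse c = Y 1 + X 1" using eq[of 1 1] by simp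
  have "d * inverse c = d * d * Y 1 + X d" "d * inverse c = Y d + d * d * X 1"
    using eq[of d 1] eq[of 1 d] by simp_all
  then have "d * d * Y 1 + X d + (Y d + d * d * X 1) = 0" by simp
  then have 2: "d * d * inverse c + (X d + Y d) = 0" unfolding 1 by (simp add: algebra_simps)
  have "d * d * inverse c = d * d * (Y d + X d)" using eq[of d d] by (simp add: algebra_simps)
  then have 3: "inverse c = X d + Y d" using assms(1) by (simp add: add.commute)
  then have "(d + 1) * (d + 1) * inverse c = 0" using 2 by (simp add: algebra_simps)
  then have "d + 1 = 0" using c_nz by simp
  then show False using assms(2) by (metis add_left_self add.commute add.right_neutral)
qed

section \<open>The kernel as a copy of \<open>F^6\<close>\<close>

definition square_sum :: "(4 \<times> 4 \<Rightarrow> 6) \<Rightarrow> 'a ^ 6 \<Rightarrow> 'a S2" where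
  "square_sum \<beta> v = (\<lambda>(I, J). if I = J \<and> I \<in> Pidx then v $ \<beta> I else 0)"

text \<open>\<open>U\<close> has a nonzero coefficient off the diagonal, so no two elements of
  \<open>SQ\<close> differ by it.\<close>

lemma Ncl_SQ_inj: "s \<in> SQ \<Longrightarrow> t \<in> SQ \<Longrightarrow> Ncl c s = Ncl c t \<Longrightarrow> s = t"
proof -
  assume st: "s \<in> SQ" "t \<in> SQ" "Ncl c s = Ncl c t"
  have "s ((1,2),(4,3)) = 0" "t ((1,2),(4,3)) = 0" using st(1,2) by (simp_all add: SQ_def)
  moreover have "Uel c ((1,2),(4,3)) \<noteq> 0" using c_nz by (simp add: Uel_apply Pidx_eq opp_def)
  ultimately have "t \<noteq> splus s (Uel c)" by (auto simp: splus_def)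
  with st(3) show "s = t" by (auto simp: Ncl_eq_iff)
qed

lemma square_sum_iso:
  assumes "bij_betw \<beta> Pidx UNIV"
  shows "(\<lambda>v. (mat 1, Ncl c (square_sum \<beta> v))) \<in> iso F6grp ((SDP c)\<lparr>carrier := {mat 1} \<times> Ncl c ` SQ\<rparr>)"
proof -
  have SQ: "square_sum \<beta> v \<in> SQ" for v by (auto simp: SQ_def S2set_def square_sum_def)
  have add: "square_sum \<beta> (v + w) = splus (square_sum \<beta> v) (square_sum \<beta> w)" for v w
    by (auto simp: square_sum_def splus_def)
  have inj: "v = w" if "square_sum \<beta> v = square_sum \<beta> w" for v w
  proof -
    have "v $ i = w $ i" for i
    proof -
      obtain I where I: "I \<in> Pidx" "i = \<beta> I" using assms unfolding bij_betw_def by blast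
      then show ?thesis using fun_cong[OF that, of "(I, I)"] by (simp add: square_sum_def)
    qed
    then show ?thesis by (simp add: vec_eq_iff)
  qed
  have surj: "\<exists>v. q = square_sum \<beta> v" if "q \<in> SQ" for q
  proof -
    define v where "v = (\<chi> i. q (inv_into Pidx \<beta> i, inv_into Pidx \<beta> i))"
    have "q (I, J) = square_sum \<beta> v (I, J)" for I J
    proof (cases "I \<in> Pidx \<and> I = J")
      case True
      then show ?thesis using assms by (auto simp: square_sum_def v_def bij_betw_def)
    next
      case False
      then have "q (I, J) = 0"
        using SQ_zero[OF that, of I J] S2set_outside[OF SQ_in_S2set[OF that], of I J] by blast
      then show ?thesis using False by (auto simp: square_sum_def)
    qed
    then have "q = square_sum \<beta> v" by (auto simp: fun_eq_iff)
    then show ?thesis ..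
  qed
  have "SQ = range (square_sum \<beta>)" using SQ surj by blast
  then have im: "range (\<lambda>v. (mat 1, Ncl c (square_sum \<beta> v))) = {mat 1} \<times> Ncl c ` SQ" by (elim ssubst) auto
  have "inj (\<lambda>v. (mat 1, Ncl c (square_sum \<beta> v)))"
    by (rule injI) (auto dest!: Ncl_SQ_inj[OF SQ SQ] inj)
  then show ?thesis
    unfolding iso_def bij_betw_def hom_def
    using SQ im by (auto simp: F6grp_def SDP_mult_Ncl SQ_in_S2set add)
qed

end

theorem theorem4p1:
  fixes c :: "'a::field"
  assumes "CHAR('a) = 2"
    and "infinite (UNIV :: 'a set) \<or> card (UNIV :: 'a set) > 2"
    and "c \<noteq> 0"
    and "C \<in> Rcomponents c"
  shows "\<exists>K. K \<lhd> (SDP c)\<lparr>carrier := stabC c C\<rparr>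
           \<and> (SDP c)\<lparr>carrier := K\<rparr> \<cong> (F6grp :: ('a ^ 6) monoid)
           \<and> ((SDP c)\<lparr>carrier := stabC c C\<rparr> Mod K) \<cong> (SLgrp :: 'a mat4 monoid)
           \<and> nonsplit_ext ((SDP c)\<lparr>carrier := stabC c C\<rparr>) K"
proof -
  interpret char_two c by standard (use assms in auto)
  interpret SDP: group "SDP c" by (rule SDP_group)
  obtain m :: "'a S2" where m: "m \<in> S2set" "subgroup (stabC c C) (SDP c)"
    and stab: "\<And>g (k :: 'a S2). g \<in> SL4 \<Longrightarrow> k \<in> S2set \<Longrightarrow> (g, Ncl c k) \<in> stabC c C \<longleftrightarrow>
       splus (splus (splus (sact g m) m) k) (splus (pot (tact g E33)) (pot E33)) \<in> SQU"
    using component_stabilizer[OF assms(4) E33_in_HV] by blast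
  define H where "H = (SDP c)\<lparr>carrier := stabC c C\<rparr>"
  have H: "group H" unfolding H_def by (rule SDP.subgroup_imp_group[OF m(2)])
  have H_carrier: "carrier H = stabC c C" and H_mult: "x \<otimes>\<^bsub>H\<^esub> y = x \<otimes>\<^bsub>SDP c\<^esub> y" for x y
    by (simp_all add: H_def)
  have H_cases: "\<exists>g k. x = (g, Ncl c k) \<and> g \<in> SL4 \<and> k \<in> S2set" if "x \<in> carrier H" for x
  proof -
    have "x \<in> carrier (SDP c)" using that by (simp add: H_carrier stabC_def)
    then show ?thesis by (rule SDP_cases) blast
  qed
  have SL: "group (SLgrp :: 'a mat4 monoid)"
  proof (rule groupI)
    fix x :: "'a mat4"
    assume "x \<in> carrier SLgrp"
    then show "\<exists>y\<in>carrier SLgrp. y \<otimes>\<^bsub>SLgrp\<^esub> x = \<one>\<^bsub>SLgrp\<^esub>"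
      using SL4_inverse[of x] by (auto simp: SLgrp_def)
  qed (auto simp: SLgrp_def SL4_mult matrix_mul_assoc)
  have "fst \<in> hom H SLgrp"
    by (auto simp: hom_def H_mult SLgrp_def SDP_mult_Ncl dest!: H_cases)
  then interpret fst: group_hom H "SLgrp :: 'a mat4 monoid" fst
    using H SL by (simp add: group_hom_def group_hom_axioms_def)
  define K where "K = kernel H (SLgrp :: 'a mat4 monoid) fst"
  have K_eq: "K = {mat 1} \<times> Ncl c ` SQ"
  proof -
    \<comment> \<open>For the identity matrix the terms in \<open>m\<close> and the potentials
      cancel, leaving only \<open>k\<close>.\<close>
    have k: "(mat 1, Ncl c k) \<in> stabC c C \<longleftrightarrow> k \<in> SQU" if "k \<in> S2set" for k
      using stab[OF SL4_one that] m by (simp add: tact_one E33_in_HV)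
    have SQU: "Ncl c ` SQU = Ncl c ` SQ"
      unfolding SQU_def image_Un image_image by (simp add: Ncl_splus_Uel)
    have "x \<in> K \<longleftrightarrow> x \<in> {mat 1} \<times> Ncl c ` SQU" for x
    proof
      assume "x \<in> K"
      then have x: "x \<in> carrier H" "fst x = mat 1" by (simp_all add: K_def kernel_def SLgrp_def)
      then obtain l where "x = (mat 1, Ncl c l)" "l \<in> S2set" using H_cases by fastforce
      then show "x \<in> {mat 1} \<times> Ncl c ` SQU" using k x by (auto simp: H_carrier)
    next
      assume "x \<in> {mat 1} \<times> Ncl c ` SQU"
      then show "x \<in> K" using k SQU_in_S2set by (auto simp: K_def kernel_def SLgrp_def H_carrier)
    qed
    then have "K = {mat 1} \<times> Ncl c ` SQU" by blast
    then show ?thesis by (simp add: SQU)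
  qed
  have surj: "fst ` carrier H = carrier (SLgrp :: 'a mat4 monoid)"
  proof (intro equalityI subsetI)
    fix g :: "'a mat4"
    assume "g \<in> carrier SLgrp"
    then have g: "g \<in> SL4" by (simp add: SLgrp_def)
    \<comment> \<open>The stabilizer condition is linear in \<open>k\<close>, so it can be solved
      for every \<open>g\<close>.\<close>
    define k where "k = splus (splus (sact g m) m) (splus (pot (tact g E33)) (pot E33))"
    have "k \<in> S2set" using m by (simp add: k_def)
    moreover have "splus (splus (splus (sact g m) m) k) (splus (pot (tact g E33)) (pot E33)) = szero"
      by (simp add: k_def splus_ac)
    ultimately have "(g, Ncl c k) \<in> stabC c C" using stab[OF g] by simp
    then show "g \<in> fst ` carrier H" by (force simp: H_carrier)
  qed (use fst.hom_closed in blast)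
  have "card Pidx = CARD(6)" by (simp add: Pidx_eq)
  then obtain \<beta> :: "4 \<times> 4 \<Rightarrow> 6" where \<beta>: "bij_betw \<beta> Pidx UNIV"
    using finite_same_card_bij[OF finite_Pidx finite_class.finite_UNIV] by blast
  have F6: "group (F6grp :: ('a ^ 6) monoid)"
    by (rule groupI) (auto simp: F6grp_def add.assoc intro: exI[of _ "- _"])
  have 1: "K \<lhd> H" unfolding K_def by (rule fst.normal_kernel)
  have 2: "(SDP c)\<lparr>carrier := K\<rparr> \<cong> (F6grp :: ('a ^ 6) monoid)"
    using group.iso_sym[OF F6] square_sum_iso[OF \<beta>] unfolding K_eq is_iso_def by blast
  have 3: "H Mod K \<cong> (SLgrp :: 'a mat4 monoid)"
    unfolding K_def by (rule fst.FactGroup_iso[OF surj])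
  have 4: "nonsplit_ext H K"
    unfolding nonsplit_ext_def
  proof
    assume "\<exists>D. subgroup D H \<and> D \<inter> K = {\<one>\<^bsub>H\<^esub>} \<and> K <#>\<^bsub>H\<^esub> D = carrier H"
    then obtain D where D: "subgroup D H" "D \<inter> K = {\<one>\<^bsub>H\<^esub>}" "K <#>\<^bsub>H\<^esub> D = carrier H" by blast
    have inj: "inj_on fst D" by (rule fst.complement_inj[OF D[unfolded K_def]])
    have "fst ` D = carrier SLgrp" unfolding surj[symmetric] by (rule fst.complement_surj[OF D[unfolded K_def]])
    then have im: "fst ` D = SL4" by (simp add: SLgrp_def)
    have DH: "x \<in> carrier H" if "x \<in> D" for x using subgroup.mem_carrier[OF D(1) that] .
    have "\<exists>k. k \<in> S2set \<and> (g, Ncl c k) \<in> D" if "g \<in> SL4" for g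
    proof -
      from that have "g \<in> fst ` D" unfolding im .
      then obtain x where x: "x \<in> D" "g = fst x" by (auto simp only:)
      obtain h k where "x = (h, Ncl c k)" "k \<in> S2set" using H_cases[OF DH[OF x(1)]] by blast
      then show ?thesis using x by auto
    qed
    \<comment> \<open>A complement gives a lift of each \<open>g\<close>; \<open>\<kappa>\<close>
      picks a representative in \<open>S_2(W)\<close> of its translation part.\<close>
    then obtain \<kappa> where \<kappa>: "\<And>g. g \<in> SL4 \<Longrightarrow> \<kappa> g \<in> S2set \<and> (g, Ncl c (\<kappa> g)) \<in> D" by metis
    define r t where "r = (transvection 3 1 :: 'a \<Rightarrow> 'a mat4)" and "t = (transvection 4 2 :: 'a \<Rightarrow> 'a mat4)"
    have rt: "r a \<in> SL4" "t a \<in> SL4" for a by (simp_all add: r_def t_def transvections_SL4)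
    have off: "(splus (splus (splus (sact g m) m) (\<kappa> g)) (splus (pot (tact g E33)) (pot E33))) (I, J) = 0"
      if "g \<in> SL4" "I \<noteq> J" "\<not> opp I J" for g I J
      using stab[OF that(1)] \<kappa>[OF that(1)] DH SQU_zero[OF _ that(2,3)] unfolding H_carrier by blast
    \<comment> \<open>The term \<open>a * inverse c\<close> is the potential difference at the base
      vertex. The second family fixes that vertex and has no such term, and this asymmetry is the
      obstruction.\<close>
    have R: "\<kappa> (r a) ((4,1),(1,2)) =
        a * inverse c + a * m ((4,1),(2,3)) + a * m ((4,3),(1,2)) + a * a * m ((4,3),(2,3))" for a
      using off[OF rt(1)[of a], of "(4,1)" "(1,2)"]
      by - (rule eq_if_add_eq_0, simp add: opp_def r_def splus_def tact_E33 pot_E33 sact_transvection algebra_simps)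
    have T: "\<kappa> (t b) ((1,2),(2,3)) = b * m ((4,3),(1,2)) + b * m ((4,1),(2,3)) + b * b * m ((4,1),(4,3))" for b
      using off[OF rt(2)[of b], of "(1,2)" "(2,3)"]
      by - (rule eq_if_add_eq_0, simp add: opp_def t_def splus_def szero_def tact_E33 sact_transvection algebra_simps)
    have main: "a * b * inverse c = a * a * (b * m ((4,3),(2,3)) + \<kappa> (t b) ((2,3),(2,3)))
       + b * b * (a * m ((4,1),(4,3)) + \<kappa> (r a) ((4,1),(4,1)))" for a b
    proof -
      let ?x = "(r a, Ncl c (\<kappa> (r a)))" and ?y = "(t b, Ncl c (\<kappa> (t b)))"
      \<comment> \<open>The lifts commute because their images do and the projection is injective on
        the complement.\<close>
      have "?x \<otimes>\<^bsub>H\<^esub> ?y = ?y \<otimes>\<^bsub>H\<^esub> ?x"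
      proof (rule inj_onD[OF inj])
        show "fst (?x \<otimes>\<^bsub>H\<^esub> ?y) = fst (?y \<otimes>\<^bsub>H\<^esub> ?x)"
          by (simp add: H_mult SDP_mult_Ncl rt) (simp add: r_def t_def transvections_commute)
      qed (use \<kappa> rt subgroup.m_closed[OF D(1)] in blast)+
      then have "Ncl c (splus (sact (t b) (\<kappa> (r a))) (\<kappa> (t b))) = Ncl c (splus (sact (r a) (\<kappa> (t b))) (\<kappa> (r a)))"
        by (simp add: H_mult SDP_mult_Ncl rt)
      \<comment> \<open>\<open>U\<close> vanishes on the diagonal, so this coefficient is well
        defined on classes.\<close>
      then have "splus (sact (t b) (\<kappa> (r a))) (\<kappa> (t b)) ((1,2),(1,2))
          = splus (sact (r a) (\<kappa> (t b))) (\<kappa> (r a)) ((1,2),(1,2))"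
        by (auto simp: Ncl_eq_iff) (simp_all add: splus_def Uel_apply opp_def)
      then have "b * \<kappa> (r a) ((4,1),(1,2)) + b * b * \<kappa> (r a) ((4,1),(4,1))
          + (a * \<kappa> (t b) ((1,2),(2,3)) + a * a * \<kappa> (t b) ((2,3),(2,3))) = 0"
        by (auto dest!: add_eq_0_if_eq simp: splus_def r_def t_def sact_transvection algebra_simps)
      \<comment> \<open>The terms \<open>a * b * m ((4,1),(2,3))\<close> and
        \<open>a * b * m ((4,3),(1,2))\<close> come from both \<open>R\<close> and \<open>T\<close>
        and cancel. The other terms in \<open>m\<close> have a factor \<open>a * a\<close> or
        \<open>b * b\<close> and join the separable part.\<close>
      then have "a * b * inverse c + (a * a * (b * m ((4,3),(2,3)) + \<kappa> (t b) ((2,3),(2,3)))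
          + b * b * (a * m ((4,1),(4,3)) + \<kappa> (r a) ((4,1),(4,1)))) = 0"
        unfolding R T by (simp add: algebra_simps)
      then show ?thesis by (rule eq_if_add_eq_0)
    qed
    \<comment> \<open>Here the field must have more than two elements.\<close>
    obtain d :: 'a where "d \<noteq> 0" "d \<noteq> 1"
    proof -
      have "\<not> (UNIV :: 'a set) \<subseteq> {0, 1}"
      proof
        assume "(UNIV :: 'a set) \<subseteq> {0, 1}"
        then have "finite (UNIV :: 'a set)" by (rule finite_subset) simp
        moreover from \<open>UNIV \<subseteq> {0, 1 :: 'a}\<close> have "card (UNIV :: 'a set) \<le> card {0, 1 :: 'a}"
          by (rule card_mono[rotated]) simp
        ultimately show False using assms(2) by simp
      qed
      then show ?thesis using that by blast
    qed
    then show False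
      by (rule inverse_not_separable[where Y = "\<lambda>b. b * m ((4,3),(2,3)) + \<kappa> (t b) ((2,3),(2,3))"
            and X = "\<lambda>a. a * m ((4,1),(4,3)) + \<kappa> (r a) ((4,1),(4,1))"]) (rule main)
  qed
  show ?thesis using 1 2 3 4 unfolding H_def by blast
qed

end
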